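(* Let $P$ be a generic cyclic configuration of an $n$-linkage. Let $e(P)$ be the number of positive entries in the string of orientations $E(P)=(\varepsilon_1,\dots,\varepsilon_n)$, let $d(P)$ be the sign of $\delta P=\sum_{i=1}^n\varepsilon_i\tan\alpha_i$, and let $\mathcal{H}(P)$ be the sign of the determinant of the Hessian at $P$ of the signed area function $A$ on the moduli space of the linkage. Then $$\mathcal{H}(P)=-\,d(P)\,(-1)^{e(P)}.$$
   Context: An $n$-linkage ($n\ge 3$) is a sequence $L=(l_1,\dots,l_n)$ of positive reals that can be realized as the consecutive edge lengths of a closed planar polygon. Indices are cyclic: $p_{n+1}=p_1$, $p_0=p_n$. A configuration of $L$ is a tuple $P=(p_1,\dots,p_n)$ of points of $\mathbb{R}^2$ with $|p_i p_{i+1}|=l_i$ for all $i$ and with the first two vertices pinned: $p_1=(0,0)$, $p_2=(0,l_1)$. Self-intersections are allowed. The moduli space $\mathcal{M}(L)\subset\mathbb{R}^{2(n-2)}$ is the set of all configurations of $L$ (listing the coordinates of $p_3,\dots,p_n$); for generic $L$ it is a smooth manifold of dimension $n-3$. The signed area is $A(P)=\frac12\sum_{i=1}^n (x_i y_{i+1}-x_{i+1}y_i)$, where $p_i=(x_i,y_i)$. A configuration is cyclic if all its vertices lie on a circle; let $O$ be the center of that circle. It is central if one of its edges passes through $O$. For generic $L$, the critical points of $A$ on $\mathcal{M}(L)$ are exactly the cyclic configurations. $\mathcal{H}(P)\in\{-1,0,1\}$ is the sign of the determinant of the Hessian of $A:\mathcal{M}(L)\to\mathbb{R}$ at the critical point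 $P$ (in any local coordinates; the determinant of the empty matrix is $1$). For a non-central cyclic configuration $P$: $\alpha_i\in(0,\pi/2)$ is half of the (unoriented, positive) angle between the vectors $\overrightarrow{Op_i}$ and $\overrightarrow{Op_{i+1}}$; $\varepsilon_i=1$ if $O$ lies to the left of the directed edge $p_ip_{i+1}$ and $\varepsilon_i=-1$ if $O$ lies to its right. Genericity: a linkage $L$ is generic if $\mathcal{M}(L)$ is smooth (i.e. no configuration of $L$ has all its vertices on one line) and $A$ is a Morse function on $\mathcal{M}(L)$. A cyclic configuration $P$ of $L$ is generic if $L$ is generic and $P$ is non-central. *)

theory Defs
  imports "HOL-Analysis.Analysis" "Jordan_Normal_Form.Determinant"
begin

type_synonym point = "real \<times> real"

(* The vertices of an n-gon are P 1, ..., P n. For i in {1..n} this is the cyclic successor: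
   nxt n i = i + 1 for i < n, and nxt n n = 1. *)
definition nxt :: "nat \<Rightarrow> nat \<Rightarrow> nat" where
  "nxt n i = Suc (i mod n)"

definition linkage :: "nat \<Rightarrow> (nat \<Rightarrow> real) \<Rightarrow> bool" where
  "linkage n l \<longleftrightarrow> n \<ge> 3 \<and> (\<forall>i\<in>{1..n}. l i > 0) \<and>
     (\<exists>P :: nat \<Rightarrow> point. \<forall>i\<in>{1..n}. dist (P i) (P (nxt n i)) = l i)"

(* Values outside {1..n} are normalised to 0, so that an n-tuple of points is a unique function and
   the product topology on nat => point restricts to the Euclidean topology on such tuples.
   The pinned vertices are kept in the tuple; they are constant on the moduli space. *)
definition moduli_space :: "nat \<Rightarrow> (nat \<Rightarrow> real) \<Rightarrow> (nat \<Rightarrow> point) set" where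
  "moduli_space n l = {P. (\<forall>i. i \<notin> {1..n} \<longrightarrow> P i = 0) \<and>
     P 1 = (0, 0) \<and> P 2 = (0, l 1) \<and>
     (\<forall>i\<in>{1..n}. dist (P i) (P (nxt n i)) = l i)}"

definition signed_area :: "nat \<Rightarrow> (nat \<Rightarrow> point) \<Rightarrow> real" where
  "signed_area n P =
     (\<Sum>i=1..n. fst (P i) * snd (P (nxt n i)) - fst (P (nxt n i)) * snd (P i)) / 2"


subsection \<open>Calculus in local coordinates\<close>

(* The coordinate space of dimension d is the library's Euclidean_space d, i.e. the functions
   u :: nat => real vanishing outside {..<d}; this allows d = 0 and d depending on n. *)

definition partial_deriv ::
  "nat \<Rightarrow> ((nat \<Rightarrow> real) \<Rightarrow> 'b::real_normed_vector) \<Rightarrow> (nat \<Rightarrow> real) \<Rightarrow> 'b" where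
  "partial_deriv j f u = vector_derivative (\<lambda>t. f (u(j := t))) (at (u j))"

(* C^k on an open subset U of Euclidean_space d, through continuous iterated partial derivatives. *)
fun Ck_on :: "nat \<Rightarrow> nat \<Rightarrow> (nat \<Rightarrow> real) set \<Rightarrow> ((nat \<Rightarrow> real) \<Rightarrow> 'b::real_normed_vector) \<Rightarrow> bool" where
  "Ck_on d 0 U f \<longleftrightarrow> continuous_on U f"
| "Ck_on d (Suc k) U f \<longleftrightarrow> continuous_on U f \<and>
     (\<forall>j<d. (\<forall>u\<in>U. (\<lambda>t. f (u(j := t))) differentiable at (u j)) \<and> Ck_on d k U (partial_deriv j f))"

definition smooth_on :: "nat \<Rightarrow> (nat \<Rightarrow> real) set \<Rightarrow> ((nat \<Rightarrow> real) \<Rightarrow> 'b::real_normed_vector) \<Rightarrow> bool" where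
  "smooth_on d U f \<longleftrightarrow> (\<forall>k. Ck_on d k U f)"

definition hessian :: "nat \<Rightarrow> ((nat \<Rightarrow> real) \<Rightarrow> real) \<Rightarrow> (nat \<Rightarrow> real) \<Rightarrow> real Matrix.mat" where
  "hessian d f u = Matrix.mat d d (\<lambda>(i, j). partial_deriv i (partial_deriv j f) u)"

(* Local coordinates on the (n-3)-dimensional moduli space, given by the inverse of the chart:
   a smooth immersion of an open set U of coordinates that is a homeomorphism onto an open subset of
   the moduli space. *)
definition local_param ::
  "nat \<Rightarrow> (nat \<Rightarrow> real) \<Rightarrow> (nat \<Rightarrow> real) set \<Rightarrow> ((nat \<Rightarrow> real) \<Rightarrow> (nat \<Rightarrow> point)) \<Rightarrow> bool" where
  "local_param n l U \<phi> \<longleftrightarrow>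
     openin (Euclidean_space (n - 3)) U \<and>
     openin (top_of_set (moduli_space n l)) (\<phi> ` U) \<and>
     (\<exists>\<psi>. homeomorphism U (\<phi> ` U) \<phi> \<psi>) \<and>
     (\<forall>i\<in>{1..n}. smooth_on (n - 3) U (\<lambda>u. \<phi> u i)) \<and>
     (\<forall>u\<in>U. \<forall>c :: nat \<Rightarrow> real.
        (\<forall>i\<in>{1..n}. (\<Sum>j<n - 3. c j *\<^sub>R partial_deriv j (\<lambda>v. \<phi> v i) u) = 0) \<longrightarrow> (\<forall>j<n - 3. c j = 0))"

definition critical_point :: "nat \<Rightarrow> (nat \<Rightarrow> real) \<Rightarrow> (nat \<Rightarrow> point) \<Rightarrow> bool" where
  "critical_point n l P \<longleftrightarrow> P \<in> moduli_space n l \<and>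
     (\<forall>U \<phi> u. local_param n l U \<phi> \<and> u \<in> U \<and> \<phi> u = P \<longrightarrow>
        (\<forall>j<n - 3. partial_deriv j (\<lambda>v. signed_area n (\<phi> v)) u = 0))"

definition morse_area :: "nat \<Rightarrow> (nat \<Rightarrow> real) \<Rightarrow> bool" where
  "morse_area n l \<longleftrightarrow> (\<forall>P. critical_point n l P \<longrightarrow>
     (\<forall>U \<phi> u. local_param n l U \<phi> \<and> u \<in> U \<and> \<phi> u = P \<longrightarrow>
        Determinant.det (hessian (n - 3) (\<lambda>v. signed_area n (\<phi> v)) u) \<noteq> 0))"

definition generic_linkage :: "nat \<Rightarrow> (nat \<Rightarrow> real) \<Rightarrow> bool" where
  "generic_linkage n l \<longleftrightarrow>
     (\<forall>P\<in>moduli_space n l. \<not> collinear (P ` {1..n})) \<and> morse_area n l"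

(* The common sign of the Hessian determinant over all local coordinates around P; the description
   operator is meaningful only where coordinates exist and the sign does not depend on them. *)
definition hessian_sign :: "nat \<Rightarrow> (nat \<Rightarrow> real) \<Rightarrow> (nat \<Rightarrow> point) \<Rightarrow> real" where
  "hessian_sign n l P = (THE s. \<exists>U \<phi> u. local_param n l U \<phi> \<and> u \<in> U \<and> \<phi> u = P \<and>
     s = sgn (Determinant.det (hessian (n - 3) (\<lambda>v. signed_area n (\<phi> v)) u)))"


subsection \<open>Cyclic configurations\<close>

definition cyclic_conf :: "nat \<Rightarrow> (nat \<Rightarrow> point) \<Rightarrow> bool" where
  "cyclic_conf n P \<longleftrightarrow> (\<exists>c r. r > 0 \<and> P ` {1..n} \<subseteq> sphere c r)"

(* Unique as soon as the vertices are cyclic and not collinear. *)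
definition circumcenter :: "nat \<Rightarrow> (nat \<Rightarrow> point) \<Rightarrow> point" where
  "circumcenter n P = (THE c. \<exists>r>0. P ` {1..n} \<subseteq> sphere c r)"

definition central_conf :: "nat \<Rightarrow> (nat \<Rightarrow> point) \<Rightarrow> bool" where
  "central_conf n P \<longleftrightarrow>
     (\<exists>i\<in>{1..n}. circumcenter n P \<in> closed_segment (P i) (P (nxt n i)))"

definition generic_cyclic_conf :: "nat \<Rightarrow> (nat \<Rightarrow> real) \<Rightarrow> (nat \<Rightarrow> point) \<Rightarrow> bool" where
  "generic_cyclic_conf n l P \<longleftrightarrow> P \<in> moduli_space n l \<and> cyclic_conf n P \<and>
     generic_linkage n l \<and> \<not> central_conf n P"

definition unoriented_angle :: "point \<Rightarrow> point \<Rightarrow> real" where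
  "unoriented_angle v w = arccos (inner v w / (norm v * norm w))"

definition half_angle :: "nat \<Rightarrow> (nat \<Rightarrow> point) \<Rightarrow> nat \<Rightarrow> real" where
  "half_angle n P i =
     unoriented_angle (P i - circumcenter n P) (P (nxt n i) - circumcenter n P) / 2"

(* Twice the signed area of the triangle p, q, x: positive iff x lies to the left of the directed
   line from p to q, negative iff it lies to the right. *)
definition side :: "point \<Rightarrow> point \<Rightarrow> point \<Rightarrow> real" where
  "side p q x = fst (q - p) * snd (x - p) - snd (q - p) * fst (x - p)"

definition edge_orientation :: "nat \<Rightarrow> (nat \<Rightarrow> point) \<Rightarrow> nat \<Rightarrow> real" where
  "edge_orientation n P i = sgn (side (P i) (P (nxt n i)) (circumcenter n P))"

definition num_positive :: "nat \<Rightarrow> (nat \<Rightarrow> point) \<Rightarrow> nat" where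
  "num_positive n P = card {i\<in>{1..n}. edge_orientation n P i > 0}"

definition delta :: "nat \<Rightarrow> (nat \<Rightarrow> point) \<Rightarrow> real" where
  "delta n P = (\<Sum>i=1..n. edge_orientation n P i * tan (half_angle n P i))"

end

theory Submission
  imports Defs
begin

text \<open>Put the circumcentre at the origin, let \<open>p i\<close> be the vertices, \<open>R\<close> the radius and
  \<open>\<tau> i = \<epsilon> i tan \<alpha> i\<close>. Lagrange multipliers turn the area near \<open>P\<close>
  into a quadratic form in the displacement \<open>w\<close> of the vertices, so the Hessian is the Gram matrix
  of this form on the tangent space. Put \<open>y i = w i \<bullet> p i\<close> and \<open>x i = p i \<times> w i\<close>.
  A tangent vector satisfies \<open>x i - x (i + 1) = \<tau> i (y i + y (i + 1))\<close>, and summation by parts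
  shows that \<open>2 R\<^sup>2\<close> times the form equals
  \<open>q(y) = \<Sum> \<tau> i (y i + y (i + 1))\<^sup>2 - (y (i + 1) - y i)\<^sup>2 / \<tau> i\<close>.

  The kernel of \<open>q\<close> on \<open>\<real>\<^sup>n\<close> consists of the vectors \<open>i \<mapsto> a \<bullet> p i\<close>, and the closing
  condition \<open>\<Sum> \<tau> i (y i + y (i + 1)) = 0\<close> says that \<open>y\<close> is \<open>q\<close>-orthogonal to the constant
  vector \<open>1\<close>. Since \<open>q(1) = 4 \<Sum> \<tau> i\<close>, the sign of the Hessian determinant is the sign of
  \<open>\<Sum> \<tau> i\<close> times the sign of \<open>q\<close> modulo its kernel, and the latter comes from a tridiagonal
  matrix. Local coordinates exist because all edges but three can be turned freely while two
  non-parallel edges close up the polygon.\<close>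

subsection \<open>Cross products and inscribed polygons\<close>

lemma sum_nxt:
  fixes f :: "nat \<Rightarrow> 'b::comm_monoid_add"
  assumes "n \<ge> 1"
  shows "(\<Sum>i=1..n. f (nxt n i)) = (\<Sum>i=1..n. f i)"
proof -
  have "bij_betw (nxt n) {1..n} {1..n}"
  proof (rule bij_betw_byWitness[where f' = "\<lambda>j. if j = 1 then n else j - 1"])
    show "nxt n ` {1..n} \<subseteq> {1..n}"
      using assms by (auto simp: nxt_def Suc_le_eq)
    show "\<forall>i\<in>{1..n}. (if nxt n i = 1 then n else nxt n i - 1) = i"
    proof
      fix i assume "i \<in> {1..n}"
      then show "(if nxt n i = 1 then n else nxt n i - 1) = i"
        by (cases "i = n") (auto simp: nxt_def)
    qed
  qed (use assms in \<open>auto simp: nxt_def\<close>)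
  then show ?thesis
    by (rule sum.reindex_bij_betw)
qed

lemma sum_nxt_telescope:
  fixes f :: "nat \<Rightarrow> real"
  assumes "n \<ge> 1"
  shows "(\<Sum>i=1..n. f (nxt n i) - f i) = 0"
  using sum_nxt[OF assms, of f] by (simp add: sum_subtractf)

lemma nxt_in: "n \<ge> 1 \<Longrightarrow> nxt n i \<in> {1..n}"
  by (auto simp: nxt_def Suc_le_eq)

lemma nxt_less: "i < n \<Longrightarrow> nxt n i = Suc i"
  by (simp add: nxt_def)

lemma nxt_self: "nxt n n = 1"
  by (simp add: nxt_def)

section \<open>Vector algebra in the plane\<close>

definition cross :: "point \<Rightarrow> point \<Rightarrow> real" where
  "cross v w = fst v * snd w - snd v * fst w"

definition rot :: "point \<Rightarrow> point" where
  "rot v = (- snd v, fst v)"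

lemma cross_self: "cross v v = 0"
  and cross_swap: "cross w v = - cross v w"
  and cross_add_left: "cross (u + v) w = cross u w + cross v w"
  and cross_add_right: "cross u (v + w) = cross u v + cross u w"
  and cross_diff_left: "cross (u - v) w = cross u w - cross v w"
  and cross_diff_right: "cross u (v - w) = cross u v - cross u w"
  and cross_minus_left: "cross (- u) v = - cross u v"
  and cross_minus_right: "cross u (- v) = - cross u v"
  and cross_scaleR_left: "cross (a *\<^sub>R u) v = a * cross u v"
  and cross_scaleR_right: "cross u (a *\<^sub>R v) = a * cross u v"
  by (simp_all add: cross_def algebra_simps)

lemma rot_add: "rot (u + v) = rot u + rot v"
  and rot_diff: "rot (u - v) = rot u - rot v"
  and rot_scaleR: "rot (a *\<^sub>R u) = a *\<^sub>R rot u"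
  and rot_rot: "rot (rot u) = - u"
  and inner_rot_left: "inner (rot u) v = cross u v"
  and inner_rot_right: "inner u (rot v) = - cross u v"
  and cross_rot_left: "cross (rot u) v = - inner u v"
  and cross_rot_right: "cross u (rot v) = inner u v"
  and inner_rot_rot: "inner (rot u) (rot v) = inner u v"
  by (simp_all add: rot_def cross_def prod_eq_iff inner_prod_def algebra_simps)

lemmas cross_linear = cross_add_left cross_add_right cross_diff_left cross_diff_right
  cross_minus_left cross_minus_right cross_scaleR_left cross_scaleR_right

text \<open>Lagrange's identity: \<open>cross\<close> and \<open>inner\<close> are the sine and
  cosine of the same angle, scaled by both lengths.\<close>

lemma cross_inner_identity:
  "(cross v w)\<^sup>2 + (inner v w)\<^sup>2 = inner v v * inner w w"
  by (simp add: cross_def inner_prod_def power2_eq_square algebra_simps)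

text \<open>Expansion in the orthogonal frame \<open>p\<close>, \<open>rot p\<close>, multiplied by
  the squared length of \<open>p\<close> to avoid division.\<close>

lemma plane_decomp: "inner p p *\<^sub>R w = inner w p *\<^sub>R p + cross p w *\<^sub>R rot p"
  by (simp add: prod_eq_iff cross_def rot_def inner_prod_def algebra_simps)

text \<open>A difference of two points is orthogonal to \<open>a\<close>, so
  \<open>plane_decomp\<close> leaves only its multiple of \<open>rot a\<close>.\<close>

lemma collinear_if_on_line:
  fixes a :: point
  assumes "a \<noteq> 0" and "\<And>x. x \<in> A \<Longrightarrow> inner a x = b"
  shows "collinear A"
  unfolding collinear_def
proof (rule exI[of _ "rot a"], intro ballI)
  fix x y assume "x \<in> A" "y \<in> A"
  then have "inner (x - y) a = 0"
    using assms(2)[of x] assms(2)[of y] by (subst inner_commute) (simp add: inner_diff_right)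
  then have "inner a a *\<^sub>R (x - y) = cross a (x - y) *\<^sub>R rot a"
    using plane_decomp[of a "x - y"] by simp
  moreover have "inner a a \<noteq> 0"
    using assms(1) by simp
  ultimately have "x - y = (cross a (x - y) / inner a a) *\<^sub>R rot a"
    by (simp add: eq_vector_fraction_iff)
  then show "\<exists>c. x - y = c *\<^sub>R rot a"
    by blast
qed

text \<open>The circumcentre is the origin. Since all vertices have length \<open>R\<close>,
  \<open>cross_p\<close> says that neighbours are neither equal nor antipodal: no edge degenerates
  or passes through the centre.\<close>

locale inscribed_polygon =
  fixes n :: nat and p :: "nat \<Rightarrow> point" and R :: real
  assumes n_ge_3: "n \<ge> 3" and R_pos: "R > 0"
    and inner_p: "\<And>i. i \<in> {1..n} \<Longrightarrow> inner (p i) (p i) = R\<^sup>2"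
    and cross_p: "\<And>i. i \<in> {1..n} \<Longrightarrow> cross (p i) (p (nxt n i)) \<noteq> 0"
begin

text \<open>With \<open>2\<beta>\<close> the oriented central angle over the edge from \<open>p i\<close> to its successor,
  \<open>tau i = (1 - cos 2\<beta>) / sin 2\<beta> = tan \<beta>\<close>.\<close>

definition tau :: "nat \<Rightarrow> real" where
  "tau i = (R\<^sup>2 - inner (p i) (p (nxt n i))) / cross (p i) (p (nxt n i))"

lemma nxt_mem: "nxt n i \<in> {1..n}"
  using n_ge_3 by (intro nxt_in) simp

lemma cross_inner_p:
  assumes "i \<in> {1..n}"
  shows "(cross (p i) (p (nxt n i)))\<^sup>2 + (inner (p i) (p (nxt n i)))\<^sup>2 = R\<^sup>2 * R\<^sup>2"
  using cross_inner_identity[of "p i" "p (nxt n i)"] inner_p assms nxt_mem by simp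

text \<open>The nonzero cross product makes the Cauchy-Schwarz inequality strict.\<close>

lemma abs_inner_p_less:
  assumes "i \<in> {1..n}"
  shows "\<bar>inner (p i) (p (nxt n i))\<bar> < R\<^sup>2"
proof -
  have "(cross (p i) (p (nxt n i)))\<^sup>2 > 0"
    using cross_p[OF assms] by simp
  then have "(inner (p i) (p (nxt n i)))\<^sup>2 < (R\<^sup>2)\<^sup>2"
    using cross_inner_p[OF assms] unfolding power2_eq_square by linarith
  then show ?thesis
    using power2_less_imp_less[of "\<bar>inner (p i) (p (nxt n i))\<bar>" "R\<^sup>2"] by simp
qed

lemma tau_nonzero: "i \<in> {1..n} \<Longrightarrow> tau i \<noteq> 0"
  using abs_inner_p_less[of i] cross_p[of i] by (auto simp: tau_def)

text \<open>The rational parametrisation of sine and cosine of the central angle by the tangent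
  \<open>tau i\<close> of its half.\<close>

lemma cross_eq_tau:
  assumes "i \<in> {1..n}"
  shows "cross (p i) (p (nxt n i)) = 2 * R\<^sup>2 * tau i / (1 + (tau i)\<^sup>2)"
    and "inner (p i) (p (nxt n i)) = R\<^sup>2 * (1 - (tau i)\<^sup>2) / (1 + (tau i)\<^sup>2)"
proof -
  define s where "s = cross (p i) (p (nxt n i))"
  define c where "c = inner (p i) (p (nxt n i))"
  have s0: "s \<noteq> 0" and sc: "s\<^sup>2 + c\<^sup>2 = R\<^sup>2 * R\<^sup>2" and "c < R\<^sup>2"
    using cross_p assms cross_inner_p abs_inner_p_less[OF assms] by (auto simp: s_def c_def)
  have t: "tau i * s = R\<^sup>2 - c"
    using s0 by (simp add: tau_def s_def c_def)
  have "s * (s - tau i * (R\<^sup>2 + c)) = s\<^sup>2 - (R\<^sup>2 - c) * (R\<^sup>2 + c)"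
    using arg_cong[OF t, of "\<lambda>x. x * (R\<^sup>2 + c)"] by (simp add: algebra_simps power2_eq_square)
  also have "\<dots> = 0"
    using sc by (simp add: algebra_simps power2_eq_square)
  \<comment> \<open>The second half-angle formula: the tangent is also the sine over one plus the
    cosine.\<close>
  finally have t2: "s = tau i * (R\<^sup>2 + c)"
    using s0 by simp
  have pos: "1 + (tau i)\<^sup>2 \<noteq> 0"
    using zero_le_power2[of "tau i"] by linarith
  have "s * (1 + (tau i)\<^sup>2) = s + tau i * (tau i * s)"
    by (simp add: algebra_simps power2_eq_square)
  also have "\<dots> = 2 * R\<^sup>2 * tau i"
    unfolding t by (subst t2) (simp add: algebra_simps)
  finally have "s * (1 + (tau i)\<^sup>2) = 2 * R\<^sup>2 * tau i" .
  then show "cross (p i) (p (nxt n i)) = 2 * R\<^sup>2 * tau i / (1 + (tau i)\<^sup>2)"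
    using pos by (simp add: s_def eq_divide_eq)
  have "(tau i)\<^sup>2 * (R\<^sup>2 + c) = tau i * s"
    by (subst t2) (simp add: power2_eq_square)
  then have "c * (1 + (tau i)\<^sup>2) = R\<^sup>2 * (1 - (tau i)\<^sup>2)"
    unfolding t by (simp add: algebra_simps)
  then show "inner (p i) (p (nxt n i)) = R\<^sup>2 * (1 - (tau i)\<^sup>2) / (1 + (tau i)\<^sup>2)"
    using pos by (simp add: c_def eq_divide_eq)
qed

text \<open>The midpoint of an edge is the multiple \<open>cot \<beta> / 2\<close> of the edge turned by a right angle.\<close>

lemma tau_edge:
  assumes "i \<in> {1..n}"
  shows "tau i *\<^sub>R rot (p i + p (nxt n i)) = p (nxt n i) - p i"
proof -
  obtain a b where p: "p i = (a, b)" by fastforce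
  obtain c d where q: "p (nxt n i) = (c, d)" by fastforce
  have R: "a * a + b * b = R\<^sup>2" "c * c + d * d = R\<^sup>2"
    using inner_p[OF assms] inner_p[OF nxt_mem, of i] p q by (auto simp: inner_prod_def)
  have nz: "a * d - b * c \<noteq> 0"
    using cross_p[OF assms] p q by (simp add: cross_def)
  have t: "tau i * (a * d - b * c) = R\<^sup>2 - (a * c + b * d)"
    using nz p q by (simp add: tau_def cross_def inner_prod_def)
  \<comment> \<open>Each coordinate of the claim, multiplied by the cross product, is an explicit
    combination of the relations in \<open>R\<close> and \<open>t\<close>.\<close>
  have "(a * d - b * c) * (tau i * (- (b + d)) - (c - a))
      = d * (a * a + b * b - R\<^sup>2) + b * (c * c + d * d - R\<^sup>2)
        - (tau i * (a * d - b * c) - (R\<^sup>2 - (a * c + b * d))) * (b + d)"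
    by (simp add: algebra_simps)
  then have "(a * d - b * c) * (tau i * (- (b + d)) - (c - a)) = 0"
    using t R by simp
  moreover have "(a * d - b * c) * (tau i * (a + c) - (d - b))
      = - c * (a * a + b * b - R\<^sup>2) - a * (c * c + d * d - R\<^sup>2)
        + (tau i * (a * d - b * c) - (R\<^sup>2 - (a * c + b * d))) * (a + c)"
    by (simp add: algebra_simps)
  then have "(a * d - b * c) * (tau i * (a + c) - (d - b)) = 0"
    using t R by simp
  ultimately have "tau i * (- (b + d)) = c - a" "tau i * (a + c) = d - b"
    using nz by simp_all
  then show ?thesis
    using p q by (simp add: rot_def)
qed

section \<open>The cyclic quadratic form of the radial components and its kernel\<close>

definition cform :: "(nat \<Rightarrow> real) \<Rightarrow> (nat \<Rightarrow> real) \<Rightarrow> real" where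
  "cform y z = (\<Sum>i=1..n. tau i * (y i + y (nxt n i)) * (z i + z (nxt n i))
     - (y (nxt n i) - y i) * (z (nxt n i) - z i) / tau i)"

lemma cform_commute: "cform y z = cform z y"
  unfolding cform_def by (intro sum.cong) (simp_all add: algebra_simps)

lemma cform_cong:
  assumes "\<And>i. i \<in> {1..n} \<Longrightarrow> y i = y' i" "\<And>i. i \<in> {1..n} \<Longrightarrow> z i = z' i"
  shows "cform y z = cform y' z'"
  unfolding cform_def using assms nxt_mem by (intro sum.cong) simp_all

lemma cform_sum_left:
  assumes "finite K"
  shows "cform (\<lambda>i. \<Sum>k\<in>K. c k * X k i) z = (\<Sum>k\<in>K. c k * cform (X k) z)"
proof -
  have "cform (\<lambda>i. \<Sum>k\<in>K. c k * X k i) z =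
    (\<Sum>i=1..n. \<Sum>k\<in>K. c k * (tau i * (X k i + X k (nxt n i)) * (z i + z (nxt n i))
     - (X k (nxt n i) - X k i) * (z (nxt n i) - z i) / tau i))"
    unfolding cform_def
    by (intro sum.cong refl)
       (simp add: sum.distrib[symmetric] sum_subtractf[symmetric] sum_distrib_left
          sum_distrib_right sum_divide_distrib algebra_simps diff_divide_distrib add_divide_distrib)
  also have "\<dots> = (\<Sum>k\<in>K. c k * cform (X k) z)"
    unfolding cform_def by (subst sum.swap) (simp add: sum_distrib_left)
  finally show ?thesis .
qed

lemma cform_sum_right:
  assumes "finite K"
  shows "cform z (\<lambda>i. \<Sum>k\<in>K. c k * X k i) = (\<Sum>k\<in>K. c k * cform z (X k))"
  using cform_sum_left[OF assms, of c X z] by (simp add: cform_commute)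

lemma cform_diff_left: "cform (\<lambda>i. y i - y' i) z = cform y z - cform y' z"
  unfolding cform_def sum_subtractf[symmetric]
  by (intro sum.cong refl) (simp add: algebra_simps diff_divide_distrib add_divide_distrib)

text \<open>These are the radial components of the translation by \<open>a\<close>, which changes
  neither the edge lengths nor the area. By \<open>tau_edge\<close>, sums and differences of
  neighbouring values turn into differences and sums of \<open>inner a (rot (p i))\<close>, and the
  summands telescope.\<close>

lemma cform_kernel: "cform (\<lambda>i. inner a (p i)) z = 0"
proof -
  have "tau i * (inner a (p i) + inner a (p (nxt n i))) * (z i + z (nxt n i))
     - (inner a (p (nxt n i)) - inner a (p i)) * (z (nxt n i) - z i) / tau i
    = - 2 * (inner a (rot (p (nxt n i))) * z (nxt n i)) - - 2 * (inner a (rot (p i)) * z i)"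
    if i: "i \<in> {1..n}" for i
  proof -
    have e: "(p (nxt n i) - p i) = tau i *\<^sub>R rot (p i + p (nxt n i))"
      using tau_edge[OF i] by simp
    \<comment> \<open>The same edge relation, turned by another right angle.\<close>
    have "rot (p (nxt n i) - p i) = - tau i *\<^sub>R (p i + p (nxt n i))"
      unfolding e rot_scaleR rot_rot by (simp add: algebra_simps)
    then have "inner a (rot (p (nxt n i) - p i)) = - tau i * inner a (p i + p (nxt n i))"
      by simp
    then have 1: "tau i * (inner a (p i) + inner a (p (nxt n i)))
      = inner a (rot (p i)) - inner a (rot (p (nxt n i)))"
      by (simp add: rot_diff inner_diff_right inner_add_right algebra_simps)
    have "inner a (p (nxt n i) - p i) = tau i * inner a (rot (p i + p (nxt n i)))"
      by (subst e) simp
    then have 2: "inner a (p (nxt n i)) - inner a (p i)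
      = tau i * (inner a (rot (p i)) + inner a (rot (p (nxt n i))))"
      by (simp add: rot_add inner_diff_right inner_add_right)
    show ?thesis
      unfolding 1 2 using tau_nonzero[OF i] by (simp add: field_simps)
  qed
  then have "cform (\<lambda>i. inner a (p i)) z =
     (\<Sum>i=1..n. - 2 * (inner a (rot (p (nxt n i))) * z (nxt n i)) - - 2 * (inner a (rot (p i)) * z i))"
    unfolding cform_def by (intro sum.cong) auto
  also have "\<dots> = 0"
    using n_ge_3 by (intro sum_nxt_telescope) simp
  finally show ?thesis .
qed

text \<open>Orthogonality to the constant vector is therefore the closing condition, and the form
  has the value \<open>4 * (\<Sum>i=1..n. tau i)\<close> on the constant vector itself.\<close>

lemma cform_one: "cform (\<lambda>i. 1) z = 2 * (\<Sum>i=1..n. tau i * (z i + z (nxt n i)))"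
  unfolding cform_def by (simp add: sum_distrib_left algebra_simps)

end

section \<open>The determinant of the form modulo its kernel\<close>

definition kron :: "nat \<Rightarrow> nat \<Rightarrow> real" where
  "kron k i = (if i = k then 1 else 0)"

lemma sgn_prod:
  fixes f :: "'a \<Rightarrow> real"
  shows "sgn (\<Prod>i\<in>A. f i) = (\<Prod>i\<in>A. sgn (f i))"
  by (induction A rule: infinite_finite_induct) (simp_all add: sgn_mult)

context inscribed_polygon
begin

text \<open>A summand is nonzero only for an edge containing both indices. The bound
  \<open>2 \<le> a\<close> excludes the neighbours \<open>n\<close> and 1.\<close>

lemma cform_kron_far:
  assumes "2 \<le> a" "Suc a < b" "b \<le> n"
  shows "cform (kron a) (kron b) = 0"
proof -
  have "tau i * (kron a i + kron a (nxt n i)) * (kron b i + kron b (nxt n i))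
     - (kron a (nxt n i) - kron a i) * (kron b (nxt n i) - kron b i) / tau i = 0"
    if "i \<in> {1..n}" for i
  proof -
    have "nxt n i = Suc i \<and> i < n \<or> nxt n i = 1 \<and> i = n"
      using that by (cases "i = n") (auto simp: nxt_def)
    then show ?thesis
      using assms by (auto simp: kron_def)
  qed
  then show ?thesis
    unfolding cform_def by (intro sum.neutral) auto
qed

text \<open>Only the edge from \<open>a\<close> to its successor contains both indices.\<close>

lemma cform_kron_next:
  assumes "2 \<le> a" "a < n"
  shows "cform (kron a) (kron (Suc a)) = tau a + 1 / tau a"
proof -
  have "cform (kron a) (kron (Suc a)) = (\<Sum>i=1..n. if i = a then tau a + 1 / tau a else 0)"
    unfolding cform_def
  proof (intro sum.cong refl)
    fix i assume i: "i \<in> {1..n}"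
    then have "nxt n i = Suc i \<and> i < n \<or> nxt n i = 1 \<and> i = n"
      by (cases "i = n") (auto simp: nxt_def)
    then show "tau i * (kron a i + kron a (nxt n i)) * (kron (Suc a) i + kron (Suc a) (nxt n i))
     - (kron a (nxt n i) - kron a i) * (kron (Suc a) (nxt n i) - kron (Suc a) i) / tau i
      = (if i = a then tau a + 1 / tau a else 0)"
      using assms by (auto simp: kron_def)
  qed
  also have "\<dots> = tau a + 1 / tau a"
    using assms by simp
  finally show ?thesis .
qed

text \<open>With \<open>tau i = tan \<beta>\<close> this is tan \<beta> + cot \<beta> = 2 / sin
  2\<beta>, the cross product being \<open>R^2 sin 2\<beta>\<close>.\<close>

lemma tau_plus_inverse:
  assumes "i \<in> {1..n}"
  shows "tau i + 1 / tau i = 2 * R\<^sup>2 / cross (p i) (p (nxt n i))"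
proof -
  have "tau i \<noteq> 0" "1 + (tau i)\<^sup>2 \<noteq> 0"
    using tau_nonzero[OF assms] zero_le_power2[of "tau i"] by (simp, linarith)
  then show ?thesis
    using R_pos by (subst cross_eq_tau(1)[OF assms]) (simp add: field_simps power2_eq_square)
qed

text \<open>The rows \<open>2, \<dots>, n - 1\<close> of the cyclic tridiagonal matrix of \<open>cform\<close>, restricted to the columns
  \<open>3, \<dots>, n\<close>, are triangular; a kernel vector that vanishes at index \<open>1\<close> expresses row \<open>2\<close> through
  the rows \<open>3, \<dots>, n\<close>.\<close>

lemma sgn_det_cform:
  "sgn (Determinant.det (Matrix.mat (n - 2) (n - 2) (\<lambda>(i, j). cform (kron (i + 3)) (kron (j + 3)))))
    = - (\<Prod>i=1..n. - sgn (cross (p i) (p (nxt n i))))"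
proof -
  define m where "m = n - 3"
  have m: "n - 2 = Suc m" and n: "n = m + 3"
    using n_ge_3 by (auto simp: m_def)
  define S where "S i = cross (p i) (p (nxt n i))" for i
  \<comment> \<open>The kernel vector \<open>inner (rot (p 1)) (p i)\<close>, which vanishes at
    index 1.\<close>
  define k where "k i = cross (p 1) (p i)" for i
  define N where "N = Matrix.mat (Suc m) (Suc m) (\<lambda>(i, j). cform (kron (i + 3)) (kron (j + 3)))"
  define M where "M = Matrix.mat (Suc m) (Suc m) (\<lambda>(i, j). cform (kron (i + 2)) (kron (j + 3)))"
  \<comment> \<open>Row 0 expresses row 2 of the form through the rows 3 to \<open>n\<close>, modulo
    the kernel vector \<open>k\<close>; below it \<open>T\<close> shifts the rows of
    \<open>N\<close> down by one.\<close>
  define T where "T = Matrix.mat (Suc m) (Suc m)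
    (\<lambda>(i, j). if i = 0 then - k (j + 3) / k 2 else if i = Suc j then 1 else 0)"
  have S0: "S i \<noteq> 0" if "i \<in> {1..n}" for i
    using that cross_p by (simp add: S_def)
  have carr: "N \<in> carrier_mat (Suc m) (Suc m)" "T \<in> carrier_mat (Suc m) (Suc m)"
    "M \<in> carrier_mat (Suc m) (Suc m)"
    by (auto simp: N_def T_def M_def)
  have k1: "k 1 = 0" by (simp add: k_def cross_self)
  have k2: "k 2 = S 1" using n by (simp add: k_def S_def nxt_def numeral_2_eq_2)
  have kn: "k n = - S n" using cross_swap[of "p 1" "p n"] by (simp add: k_def S_def nxt_self)
  have k_ne: "k 2 \<noteq> 0" using k2 S0[of 1] n by simp

  have "T * N = M"
  proof (rule eq_matI)
    fix i j assume "i < dim_row M" "j < dim_col M"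
    then have i: "i < Suc m" and j: "j < Suc m" by (auto simp: M_def)
    define z where "z = kron (j + 3)"
    have "(T * N) $$ (i, j) = (\<Sum>r<Suc m. T $$ (i, r) * cform (kron (r + 3)) z)"
      using i j carr by (simp add: scalar_prod_def N_def atLeast0LessThan z_def)
    also have "\<dots> = cform (\<lambda>x. \<Sum>r<Suc m. T $$ (i, r) * kron (r + 3) x) z"
      by (subst cform_sum_left) simp_all
    also have "\<dots> = cform (kron (i + 2)) z"
    proof (cases i)
      case 0
      \<comment> \<open>Subtracting the kernel vector, normalised at index 2, from the basis vector
        2 leaves a vector that vanishes at 1 and 2.\<close>
      have "(\<Sum>r<Suc m. T $$ (i, r) * kron (r + 3) x) = kron 2 x - inner ((1 / k 2) *\<^sub>R rot (p 1)) (p x)"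
        if x: "x \<in> {1..n}" for x
      proof -
        have "(\<Sum>r<Suc m. T $$ (i, r) * kron (r + 3) x)
          = (\<Sum>r<Suc m. if r = x - 3 then (if x \<ge> 3 then - k x / k 2 else 0) else 0)"
          using 0 by (intro sum.cong refl) (auto simp: T_def kron_def)
        also have "\<dots> = (if x \<ge> 3 then - k x / k 2 else 0)"
          using x n by (subst sum.delta) auto
        also have "\<dots> = kron 2 x - k x / k 2"
        proof -
          have "x = 1 \<or> x = 2 \<or> x \<ge> 3" using x by auto
          then show ?thesis using k1 k_ne by (auto simp: kron_def)
        qed
        finally show ?thesis
          by (simp add: inner_rot_left k_def)
      qed
      then have "cform (\<lambda>x. \<Sum>r<Suc m. T $$ (i, r) * kron (r + 3) x) z
        = cform (\<lambda>x. kron 2 x - inner ((1 / k 2) *\<^sub>R rot (p 1)) (p x)) z"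
        by (intro cform_cong) auto
      also have "\<dots> = cform (kron 2) z"
        by (simp only: cform_diff_left cform_kernel diff_zero)
      finally show ?thesis using 0 by (simp add: numeral_2_eq_2)
    next
      case (Suc i')
      have "(\<lambda>x. \<Sum>r<Suc m. T $$ (i, r) * kron (r + 3) x)
        = (\<lambda>x. \<Sum>r<Suc m. if r = i' then kron (r + 3) x else 0)"
        using Suc i by (intro ext sum.cong refl) (auto simp: T_def)
      also have "\<dots> = kron (i' + 3)"
        using Suc i by (intro ext, subst sum.delta) auto
      finally show ?thesis
        using Suc by (simp add: numeral_3_eq_3 numeral_2_eq_2)
    qed
    also have "\<dots> = M $$ (i, j)"
      using i j by (simp add: M_def z_def)
    finally show "(T * N) $$ (i, j) = M $$ (i, j)" .
  qed (use carr in auto)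
  then have "Determinant.det T * Determinant.det N = Determinant.det M"
    using det_mult[OF carr(2) carr(1)] by simp
  moreover have "Determinant.det T = (-1) ^ m * (S n / S 1)"
  proof -
    \<comment> \<open>In the last column of \<open>T\<close> only the top entry is nonzero, and
      deleting its row and column leaves the identity.\<close>
    have "Determinant.det T = (\<Sum>i<Suc m. T $$ (i, m) * cofactor T i m)"
      by (rule laplace_expansion_column[OF carr(2)]) simp
    also have "\<dots> = (\<Sum>i<Suc m. if i = 0 then T $$ (0, m) * cofactor T 0 m else 0)"
      by (intro sum.cong refl) (auto simp: T_def)
    also have "\<dots> = T $$ (0, m) * cofactor T 0 m"
      by simp
    also have "mat_delete T 0 m = 1\<^sub>m m"
      by (rule eq_matI) (auto simp: mat_delete_def T_def)
    then have "cofactor T 0 m = (-1) ^ m"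
      by (simp add: cofactor_def)
    also have "T $$ (0, m) = S n / S 1"
      using kn k2 n by (simp add: T_def)
    finally show ?thesis by simp
  qed
  moreover have "Determinant.det M = (\<Prod>i<Suc m. 2 * R\<^sup>2 / S (i + 2))"
  proof -
    have "Determinant.det M = prod_list (diag_mat M)"
    \<comment> \<open>Row \<open>i\<close> stands for index \<open>i + 2\<close> and column
      \<open>j\<close> for \<open>j + 3\<close>: entries above the diagonal pair indices at distance
      at least two, the diagonal pairs neighbours.\<close>
    proof (rule det_lower_triangular[OF _ carr(3)])
      fix i j assume "i < j" "j < Suc m"
      then show "M $$ (i, j) = 0"
        using cform_kron_far[of "i + 2" "j + 3"] n by (simp add: M_def)
    qed
    also have "\<dots> = (\<Prod>i<Suc m. M $$ (i, i))"
      using carr(3) by (simp add: prod_list_diag_prod atLeast0LessThan)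
    also have "\<dots> = (\<Prod>i<Suc m. 2 * R\<^sup>2 / S (i + 2))"
    proof (intro prod.cong refl)
      fix i assume "i \<in> {..<Suc m}"
      then have "M $$ (i, i) = cform (kron (i + 2)) (kron (Suc (i + 2)))"
        by (simp add: M_def numeral_3_eq_3 numeral_2_eq_2)
      also have "\<dots> = 2 * R\<^sup>2 / S (i + 2)"
        using \<open>i \<in> {..<Suc m}\<close> n
        using cform_kron_next[of "i + 2"] tau_plus_inverse[of "i + 2"] by (simp add: S_def)
      finally show "M $$ (i, i) = 2 * R\<^sup>2 / S (i + 2)" .
    qed
    finally show ?thesis .
  qed
  ultimately have eq: "(-1) ^ m * (S n / S 1) * Determinant.det N
    = (\<Prod>i<Suc m. 2 * R\<^sup>2 / S (i + 2))"
    by simp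
  define \<sigma> where "\<sigma> i = sgn (S i)" for i
  have sq: "\<sigma> i * \<sigma> i = 1" if "i \<in> {1..n}" for i
    using S0[OF that] by (auto simp: \<sigma>_def sgn_if)
  have sgn_term: "sgn (2 * R\<^sup>2 / S i) = \<sigma> i" for i
    using R_pos by (cases "S i" "0 :: real" rule: linorder_cases)
      (simp_all add: \<sigma>_def zero_less_divide_iff divide_less_0_iff)
  have "sgn ((-1) ^ m * (S n / S 1) * Determinant.det N) = (\<Prod>i<Suc m. \<sigma> (i + 2))"
    unfolding eq sgn_prod sgn_term ..
  have e1: "(-1) ^ m * \<sigma> n * \<sigma> 1 * sgn (Determinant.det N) = (\<Prod>i<Suc m. \<sigma> (i + 2))"
  proof -
    have "sgn ((-1) ^ m :: real) = (-1) ^ m"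
      by (cases "even m") auto
    moreover have "sgn (S n / S 1) = \<sigma> n * \<sigma> 1"
      using S0[of n] S0[of 1] n
      by (auto simp: \<sigma>_def sgn_if zero_less_divide_iff divide_less_0_iff linorder_neq_iff)
    ultimately show ?thesis
      using \<open>sgn ((-1) ^ m * (S n / S 1) * Determinant.det N) = (\<Prod>i<Suc m. \<sigma> (i + 2))\<close>
      by (simp only: sgn_mult mult.assoc)
  qed
  \<comment> \<open>All signs square to 1, so \<open>e1\<close> can be solved for the sign of the
    determinant without division.\<close>
  have "sgn (Determinant.det N) = ((-1) ^ m * (-1) ^ m) * (\<sigma> n * \<sigma> n) * (\<sigma> 1 * \<sigma> 1) * sgn (Determinant.det N)"
    using sq[of n] sq[of 1] n by (simp add: power_mult_distrib[symmetric])
  also have "\<dots> = (-1) ^ m * \<sigma> n * \<sigma> 1 * ((-1) ^ m * \<sigma> n * \<sigma> 1 * sgn (Determinant.det N))"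
    by (simp add: mult_ac)
  also have "\<dots> = (-1) ^ m * \<sigma> n * \<sigma> 1 * (\<Prod>i<Suc m. \<sigma> (i + 2))"
    unfolding e1 by simp
  also have "\<dots> = - (\<Prod>i=1..n. - \<sigma> i)"
  proof -
    have "(\<Prod>i=1..n. - \<sigma> i) = (-1) ^ n * (\<Prod>i=1..n. \<sigma> i)"
      using prod.distrib[of "\<lambda>i. - 1" \<sigma> "{1..n}"] by simp
    also have "(\<Prod>i=1..n. \<sigma> i) = \<sigma> 1 * (\<Prod>i=2..n. \<sigma> i)"
      using n by (subst prod.atLeast_Suc_atMost) (auto simp: numeral_2_eq_2)
    also have "(\<Prod>i=2..n. \<sigma> i) = (\<Prod>i=2..m+2. \<sigma> i) * \<sigma> n"
      unfolding n by (simp add: numeral_3_eq_3)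
    also have "(\<Prod>i=2..m+2. \<sigma> i) = (\<Prod>i<Suc m. \<sigma> (i + 2))"
      using prod.shift_bounds_cl_nat_ivl[of \<sigma> 0 2 m]
      by (simp only: lessThan_Suc_atMost atLeast0AtMost add_0)
    \<comment> \<open>Since \<open>n = m + 3\<close>, the factor \<open>(-1) ^ m\<close> equals
      \<open>- (-1) ^ n\<close>.\<close>
    finally show ?thesis
      unfolding n by (simp add: mult_ac power_add)
  qed
  finally show ?thesis
    unfolding m by (simp add: N_def S_def \<sigma>_def)
qed

text \<open>The \<open>y j\<close> together with the constant vector, shifted by a kernel vector so
  as to vanish at 1 and 2, have the Gram matrix \<open>H = C^T N C\<close>. Orthogonality makes
  \<open>H\<close> block diagonal with blocks \<open>G\<close> and \<open>4 * \<delta>\<close>, so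
  \<open>4 \<delta> det G = det N (det C)^2\<close>. For \<delta> = 0 a kernel vector of
  \<open>G\<close> is exhibited instead.\<close>

lemma sgn_det_cform_tangent:
  fixes y :: "nat \<Rightarrow> nat \<Rightarrow> real"
  assumes a: "inner a (p 1) = 1" "inner a (p 2) = 1" "i0 \<in> {1..n}" "inner a (p i0) \<noteq> 1"
    and y12: "\<And>j. j < n - 3 \<Longrightarrow> y j 1 = 0" "\<And>j. j < n - 3 \<Longrightarrow> y j 2 = 0"
    and orth: "\<And>j. j < n - 3 \<Longrightarrow> (\<Sum>i=1..n. tau i * (y j i + y j (nxt n i))) = 0"
    and indep: "\<And>c. (\<And>i. i \<in> {1..n} \<Longrightarrow> (\<Sum>j<n - 3. c j * y j i) = 0) \<Longrightarrow> (\<And>j. j < n - 3 \<Longrightarrow> c j = 0)"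
  shows "sgn (Determinant.det (Matrix.mat (n - 3) (n - 3) (\<lambda>(i, j). cform (y i) (y j))))
    = - sgn (\<Sum>i=1..n. tau i) * (\<Prod>i=1..n. - sgn (cross (p i) (p (nxt n i))))"
proof -
  define m where "m = n - 3"
  have m: "n - 2 = Suc m" and n: "n = m + 3"
    using n_ge_3 by (auto simp: m_def)
  define \<delta> where "\<delta> = (\<Sum>i=1..n. tau i)"
  \<comment> \<open>It pairs with every vector as the constant vector does, vanishes at 1 and 2, and
    is nonzero at \<open>i0\<close>.\<close>
  define o' where "o' i = 1 - inner a (p i)" for i
  define Y where "Y j = (if j < m then y j else o')" for j
  define G where "G = Matrix.mat m m (\<lambda>(i, j). cform (y i) (y j))"
  define N where "N = Matrix.mat (Suc m) (Suc m) (\<lambda>(i, j). cform (kron (i + 3)) (kron (j + 3)))"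
  define C where "C = Matrix.mat (Suc m) (Suc m) (\<lambda>(i, j). Y j (i + 3))"
  define H where "H = Matrix.mat (Suc m) (Suc m) (\<lambda>(i, j). cform (Y i) (Y j))"
  have carr: "N \<in> carrier_mat (Suc m) (Suc m)" "C \<in> carrier_mat (Suc m) (Suc m)"
    "H \<in> carrier_mat (Suc m) (Suc m)" "G \<in> carrier_mat m m"
    by (auto simp: N_def C_def H_def G_def)
  have Y12: "Y j 1 = 0" "Y j 2 = 0" for j
    using y12 a by (auto simp: Y_def o'_def m_def)
  have o'_left: "cform o' z = cform (\<lambda>i. 1) z" for z
    unfolding o'_def by (simp only: cform_diff_left cform_kernel diff_zero)
  have yo: "cform (y j) o' = 0" "cform o' (y j) = 0" if "j < m" for j
    using orth[of j] that by (simp_all add: cform_commute[of "y j"] o'_left cform_one m_def)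
  have oo: "cform o' o' = 4 * \<delta>"
    unfolding o'_left by (subst cform_commute, unfold o'_left)
      (simp add: cform_one \<delta>_def sum_distrib_left mult.commute)
  have expand: "Y j x = (\<Sum>r<Suc m. Y j (r + 3) * kron (r + 3) x)" if x: "x \<in> {1..n}" for j x
  proof -
    have "(\<Sum>r<Suc m. Y j (r + 3) * kron (r + 3) x)
      = (\<Sum>r<Suc m. if r = x - 3 then (if x \<ge> 3 then Y j x else 0) else 0)"
      by (intro sum.cong refl) (auto simp: kron_def)
    also have "\<dots> = (if x \<ge> 3 then Y j x else 0)"
      using x n by (subst sum.delta) auto
    also have "\<dots> = Y j x"
    proof -
      have "x = 1 \<or> x = 2 \<or> x \<ge> 3" using x by auto
      then show ?thesis using Y12 by auto
    qed
    finally show ?thesis by simp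
  qed
  have "transpose_mat C * N * C = H"
  proof (rule eq_matI)
    fix i j assume "i < dim_row H" "j < dim_col H"
    then have i: "i < Suc m" and j: "j < Suc m" by (auto simp: H_def)
    have "cform (Y i) (Y j) = cform (\<lambda>x. \<Sum>r<Suc m. Y i (r + 3) * kron (r + 3) x)
      (\<lambda>x. \<Sum>r<Suc m. Y j (r + 3) * kron (r + 3) x)"
      using expand by (intro cform_cong) auto
    also have "\<dots> = (\<Sum>s<Suc m. Y j (s + 3) * (\<Sum>r<Suc m. Y i (r + 3) * cform (kron (r + 3)) (kron (s + 3))))"
      by (simp only: cform_sum_left cform_sum_right finite_lessThan sum_distrib_left, subst sum.swap)
         (simp only: mult.left_commute)
    also have "\<dots> = (transpose_mat C * N * C) $$ (i, j)"
      using i j carr by (simp add: scalar_prod_def N_def C_def atLeast0LessThan mult.commute)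
    finally show "(transpose_mat C * N * C) $$ (i, j) = H $$ (i, j)"
      using i j by (simp add: H_def)
  qed (use carr in auto)
  then have "Determinant.det H = Determinant.det (transpose_mat C * N) * Determinant.det C"
    using det_mult[of "transpose_mat C * N" "Suc m" C] carr by auto
  also have "\<dots> = Determinant.det N * (Determinant.det C)\<^sup>2"
    using det_mult[of "transpose_mat C" "Suc m" N] carr det_transpose[of C "Suc m"]
    by (auto simp: power2_eq_square)
  finally have HN: "Determinant.det H = Determinant.det N * (Determinant.det C)\<^sup>2" .
  \<comment> \<open>By \<open>yo\<close> the last row and column vanish off the diagonal.\<close>
  have "H = four_block_mat G (0\<^sub>m m 1) (0\<^sub>m 1 m) (Matrix.mat 1 1 (\<lambda>_. 4 * \<delta>))"
    using carr by (intro eq_matI) (auto simp: H_def G_def Y_def yo oo less_Suc_eq)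
  then have HG: "Determinant.det H = Determinant.det G * (4 * \<delta>)"
    using carr by (simp add: det_four_block_mat_upper_right_zero[of _ m _ 1] det_single)
  have N0: "sgn (Determinant.det N) = - (\<Prod>i=1..n. - sgn (cross (p i) (p (nxt n i))))"
    using sgn_det_cform unfolding m N_def .
  have N0': "Determinant.det N \<noteq> 0"
  proof
    assume "Determinant.det N = 0"
    then have "(\<Prod>i=1..n. - sgn (cross (p i) (p (nxt n i)))) = 0"
      using N0 by simp
    then show False
      using cross_p by (auto simp: sgn_zero_iff)
  qed
  \<comment> \<open>All \<open>Y j\<close> vanish at 1 and 2, so a dependence of the columns of
    \<open>C\<close> holds at every index.\<close>
  have C_dep: "\<exists>v. (\<exists>j<Suc m. v j \<noteq> 0) \<and> (\<forall>i\<in>{1..n}. (\<Sum>j<Suc m. v j * Y j i) = 0)"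
    if C0: "Determinant.det C = 0"
  proof -
    obtain v where v: "v \<in> carrier_vec (Suc m)" "v \<noteq> 0\<^sub>v (Suc m)" "C *\<^sub>v v = 0\<^sub>v (Suc m)"
      using C0 det_0_iff_vec_prod_zero_field[OF carr(2)] by blast
    have "\<exists>j<Suc m. vec_index v j \<noteq> 0"
      using v(1,2) by (metis eq_vecI index_zero_vec carrier_vecD)
    moreover have "(\<Sum>j<Suc m. vec_index v j * Y j i) = 0" if i: "i \<in> {1..n}" for i
    proof -
      have "i = 1 \<or> i = 2 \<or> i \<ge> 3" using i by auto
      moreover have ?thesis if "i \<ge> 3"
      proof -
        have "vec_index (C *\<^sub>v v) (i - 3) = (\<Sum>j<Suc m. Y j i * vec_index v j)"
          using v(1) i that n by (auto simp: C_def scalar_prod_def atLeast0LessThan)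
        then show ?thesis
          using v(3) i that n by (simp add: mult.commute)
      qed
      ultimately show ?thesis using Y12 by auto
    qed
    ultimately show ?thesis by blast
  qed
  have "sgn (Determinant.det G) = sgn \<delta> * sgn (Determinant.det N)"
  proof (cases "\<delta> = 0")
    case False
    have "Determinant.det C \<noteq> 0"
    proof
      assume "Determinant.det C = 0"
      from C_dep[OF this] obtain v where v: "\<exists>j<Suc m. v j \<noteq> 0"
        "\<And>i. i \<in> {1..n} \<Longrightarrow> (\<Sum>j<Suc m. v j * Y j i) = 0" by blast
      \<comment> \<open>Pairing the dependence with \<open>o'\<close> isolates its last coefficient,
        because the \<open>y j\<close> are orthogonal to \<open>o'\<close>.\<close>
      have "0 = cform (\<lambda>i. \<Sum>j<Suc m. v j * Y j i) o'"
        using cform_cong[of "\<lambda>i. \<Sum>j<Suc m. v j * Y j i" "\<lambda>i. 0" o' o'] v(2)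
        by (simp add: cform_def)
      also have "\<dots> = v m * (4 * \<delta>)"
        by (subst cform_sum_left) (simp_all add: Y_def yo oo)
      finally have vm: "v m = 0" using False by simp
      have "(\<Sum>j<m. v j * y j i) = 0" if "i \<in> {1..n}" for i
        using v(2)[OF that] vm by (simp add: Y_def)
      then have "v j = 0" if "j < m" for j
        using indep[of v j] that by (simp add: m_def)
      then show False using v(1) vm by (auto simp: less_Suc_eq)
    qed
    then have "sgn ((Determinant.det C)\<^sup>2) = 1"
      by (metis sgn_pos zero_less_power2)
    then have "sgn (Determinant.det N) = sgn (Determinant.det G) * sgn \<delta>"
      using arg_cong[OF HN[unfolded HG], of sgn] by (simp add: sgn_mult)
    moreover have "sgn \<delta> * sgn \<delta> = 1"
      using False by (simp add: sgn_if)
    ultimately show ?thesis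
      by (metis mult.commute mult.left_neutral mult.assoc)
  next
    case True
    \<comment> \<open>Here \<open>det H = 0\<close> while \<open>det N\<close> is nonzero. The
      resulting dependence involves some \<open>y j\<close>, as \<open>o' i0\<close> is nonzero;
      pairing it with each \<open>y i\<close> gives a kernel vector of \<open>G\<close>.\<close>
    then have "Determinant.det C = 0"
      using HN HG N0' by simp
    from C_dep[OF this] obtain v where v: "\<exists>j<Suc m. v j \<noteq> 0"
      "\<And>i. i \<in> {1..n} \<Longrightarrow> (\<Sum>j<Suc m. v j * Y j i) = 0" by blast
    have v': "\<exists>j<m. v j \<noteq> 0"
    proof (rule ccontr)
      assume "\<not> ?thesis"
      then have "v m \<noteq> 0" "\<And>j. j < m \<Longrightarrow> v j = 0" using v(1) by (auto simp: less_Suc_eq)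
      then show False
        using v(2)[OF a(3)] a(4) by (simp add: Y_def o'_def)
    qed
    have "G *\<^sub>v Matrix.vec m v = 0\<^sub>v m"
    proof (rule eq_vecI)
      fix i assume "i < dim_vec (0\<^sub>v m :: real Matrix.vec)"
      then have i: "i < m" by simp
      have "0 = cform (\<lambda>x. \<Sum>j<Suc m. v j * Y j x) (y i)"
        using cform_cong[of "\<lambda>i. \<Sum>j<Suc m. v j * Y j i" "\<lambda>i. 0" "y i" "y i"] v(2)
        by (simp add: cform_def)
      also have "\<dots> = (\<Sum>j<m. v j * cform (y i) (y j))"
        using i by (subst cform_sum_left) (simp_all add: Y_def yo cform_commute[of _ "y i"])
      also have "\<dots> = vec_index (G *\<^sub>v Matrix.vec m v) i"
        using i by (simp add: G_def scalar_prod_def atLeast0LessThan mult.commute)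
      finally show "vec_index (G *\<^sub>v Matrix.vec m v) i = vec_index (0\<^sub>v m) i"
        using i by simp
    qed (simp add: G_def)
    moreover have "Matrix.vec m v \<noteq> 0\<^sub>v m"
      using v' by (metis index_vec index_zero_vec(1))
    ultimately have "Determinant.det G = 0"
      using det_0_iff_vec_prod_zero_field[OF carr(4)] vec_carrier by blast
    then show ?thesis using True by simp
  qed
  then show ?thesis
    unfolding N0 by (simp add: G_def m_def \<delta>_def)
qed

end

subsection \<open>Partial derivatives and the expansion of the area\<close>

lemma bounded_bilinear_cross: "bounded_bilinear cross"
proof -
  have "bounded_bilinear (\<lambda>v w. inner (rot v) w)"
  proof (rule bounded_bilinear.comp1[OF bounded_bilinear_inner])
    show "bounded_linear rot"
      unfolding linear_conv_bounded_linear[symmetric]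
      by (rule linearI) (simp_all add: rot_add rot_scaleR)
  qed
  then show ?thesis
    by (simp add: inner_rot_left)
qed

text \<open>\<open>Euclidean_space d\<close> carries the subspace topology of the product, and
  changing a coordinate below \<open>d\<close> is continuous and stays in the space.\<close>

lemma eventually_update_in:
  fixes v :: "nat \<Rightarrow> real"
  assumes "openin (Euclidean_space d) U" "v \<in> U" "j < d"
  shows "eventually (\<lambda>t. v(j := t) \<in> U) (nhds (v j))"
proof -
  obtain T where T: "openin (powertop_real UNIV) T" "U = T \<inter> {x. \<forall>i\<ge>d. x i = 0}"
    using assms(1) by (auto simp: Euclidean_space_def openin_subtopology)
  then have "open T"
    by (simp add: euclidean_product_topology)
  have "continuous_on UNIV (\<lambda>t. (v(j := t)) i)" for i
    by (cases "i = j") auto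
  then have "continuous_on UNIV (\<lambda>t. v(j := t))"
    by (rule continuous_on_coordinatewise_then_product)
  then have "open ((\<lambda>t. v(j := t)) -` T)"
    using \<open>open T\<close> by (simp add: continuous_on_open_vimage[OF open_UNIV])
  moreover have "v j \<in> (\<lambda>t. v(j := t)) -` T"
    using assms(2) T by simp
  ultimately have "eventually (\<lambda>t. t \<in> (\<lambda>t. v(j := t)) -` T) (nhds (v j))"
    by (rule eventually_nhds_in_open)
  then show ?thesis
    using assms T(2) by (elim eventually_mono) auto
qed

text \<open>Agreement on the open set \<open>U\<close> gives agreement along the coordinate line
  near \<open>v\<close>, so formulas valid only on a chart domain may be differentiated.\<close>

lemma partial_deriv_eqI:
  assumes "openin (Euclidean_space d) U" "v \<in> U" "j < d"
    and "\<And>x. x \<in> U \<Longrightarrow> f x = g x"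
    and "((\<lambda>t. g (v(j := t))) has_vector_derivative D) (at (v j))"
  shows "((\<lambda>t. f (v(j := t))) has_vector_derivative D) (at (v j))"
    and "partial_deriv j f v = D"
proof -
  have "eventually (\<lambda>t. f (v(j := t)) = g (v(j := t))) (nhds (v j))"
    using eventually_update_in[OF assms(1-3)] by eventually_elim (rule assms(4))
  then show *: "((\<lambda>t. f (v(j := t))) has_vector_derivative D) (at (v j))"
    using assms(2,4,5)
      has_vector_derivative_cong_ev[where S = UNIV and x = "v j" and f' = D
        and f = "\<lambda>t. f (v(j := t))" and g = "\<lambda>t. g (v(j := t))"]
    by simp
  show "partial_deriv j f v = D"
    unfolding partial_deriv_def by (rule vector_derivative_at[OF *])
qed

lemma smooth_on_partial:
  assumes "smooth_on d U f" "v \<in> U" "j < d"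
  shows "((\<lambda>t. f (v(j := t))) has_vector_derivative partial_deriv j f v) (at (v j))"
proof -
  have "Ck_on d (Suc 0) U f"
    using assms(1) unfolding smooth_on_def by blast
  then show ?thesis
    using assms(2,3) by (simp add: partial_deriv_def vector_derivative_works[symmetric])
qed

lemma smooth_on_partial_deriv:
  assumes "smooth_on d U f" "j < d"
  shows "smooth_on d U (partial_deriv j f)"
  unfolding smooth_on_def
proof
  fix k
  have "Ck_on d (Suc k) U f"
    using assms(1) unfolding smooth_on_def by blast
  then show "Ck_on d k U (partial_deriv j f)"
    using assms(2) by simp
qed

section \<open>The second-order form of the area\<close>

context inscribed_polygon
begin

text \<open>Polar form of the second derivative of the Lagrange function: the area minus the squared
  edge lengths with weights \<open>1 / (4 * tau i)\<close>.\<close>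

definition qform :: "(nat \<Rightarrow> point) \<Rightarrow> (nat \<Rightarrow> point) \<Rightarrow> real" where
  "qform v w = (\<Sum>i=1..n. (cross (v i) (w (nxt n i)) + cross (w i) (v (nxt n i))) / 2
     - inner (v (nxt n i) - v i) (w (nxt n i) - w i) / (2 * tau i))"

lemma qform_commute: "qform v w = qform w v"
  unfolding qform_def by (intro sum.cong refl) (simp add: add.commute inner_commute)

lemma qform_zero_left: "(\<And>i. i \<in> {1..n} \<Longrightarrow> v i = 0) \<Longrightarrow> qform v w = 0"
  unfolding qform_def using nxt_mem by (intro sum.neutral) (auto simp: cross_def)

lemma has_vector_derivative_qform:
  assumes f: "\<And>i. i \<in> {1..n} \<Longrightarrow> ((\<lambda>t. f t i) has_vector_derivative f' i) (at s)"
    and g: "\<And>i. i \<in> {1..n} \<Longrightarrow> ((\<lambda>t. g t i) has_vector_derivative g' i) (at s)"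
  shows "((\<lambda>t. qform (f t) (g t)) has_vector_derivative (qform f' (g s) + qform (f s) g')) (at s)"
  unfolding qform_def sum.distrib[symmetric]
proof (rule has_vector_derivative_sum)
  fix i assume i: "i \<in> {1..n}"
  note bl = bounded_bilinear.has_vector_derivative[OF bounded_bilinear_cross]
    bounded_bilinear.has_vector_derivative[OF bounded_bilinear_inner]
  note d = f[OF i] g[OF i] f[OF nxt_mem[of i]] g[OF nxt_mem[of i]]
  have *: "((\<lambda>t. (cross (f t i) (g t (nxt n i)) + cross (g t i) (f t (nxt n i))) / 2
     - inner (f t (nxt n i) - f t i) (g t (nxt n i) - g t i) / (2 * tau i)) has_vector_derivative
     ((cross (f s i) (g' (nxt n i)) + cross (f' i) (g s (nxt n i)))
       + (cross (g s i) (f' (nxt n i)) + cross (g' i) (f s (nxt n i)))) / 2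
     - (inner (f s (nxt n i) - f s i) (g' (nxt n i) - g' i)
       + inner (f' (nxt n i) - f' i) (g s (nxt n i) - g s i)) / (2 * tau i)) (at s)"
    by (intro has_vector_derivative_diff has_vector_derivative_add has_vector_derivative_divide bl d)
  show "((\<lambda>t. (cross (f t i) (g t (nxt n i)) + cross (g t i) (f t (nxt n i))) / 2
     - inner (f t (nxt n i) - f t i) (g t (nxt n i) - g t i) / (2 * tau i)) has_vector_derivative
     ((cross (f' i) (g s (nxt n i)) + cross (g s i) (f' (nxt n i))) / 2
     - inner (f' (nxt n i) - f' i) (g s (nxt n i) - g s i) / (2 * tau i)
     + ((cross (f s i) (g' (nxt n i)) + cross (g' i) (f s (nxt n i))) / 2
     - inner (f s (nxt n i) - f s i) (g' (nxt n i) - g' i) / (2 * tau i)))) (at s)"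
  proof (rule has_vector_derivative_eq_rhs[OF *])
    have aux: "((\<alpha> + \<beta>) + (\<gamma> + \<delta>)) / 2 - (\<epsilon> + \<zeta>) / T
        = (\<beta> + \<gamma>) / 2 - \<zeta> / T + ((\<alpha> + \<delta>) / 2 - \<epsilon> / T)" for \<alpha> \<beta> \<gamma> \<delta> \<epsilon> \<zeta> T :: real
      by (simp add: add_divide_distrib)
    show "((cross (f s i) (g' (nxt n i)) + cross (f' i) (g s (nxt n i)))
       + (cross (g s i) (f' (nxt n i)) + cross (g' i) (f s (nxt n i)))) / 2
     - (inner (f s (nxt n i) - f s i) (g' (nxt n i) - g' i)
       + inner (f' (nxt n i) - f' i) (g s (nxt n i) - g s i)) / (2 * tau i)
     = (cross (f' i) (g s (nxt n i)) + cross (g s i) (f' (nxt n i))) / 2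
     - inner (f' (nxt n i) - f' i) (g s (nxt n i) - g s i) / (2 * tau i)
     + ((cross (f s i) (g' (nxt n i)) + cross (g' i) (f s (nxt n i))) / 2
     - inner (f s (nxt n i) - f s i) (g' (nxt n i) - g' i) / (2 * tau i))"
      by (rule aux)
  qed
qed

text \<open>The circumcentre gives the Lagrange multipliers \<open>1 / (4 tau i)\<close> for the squared edge lengths,
  and the Lagrange function is a quadratic polynomial, so the expansion at \<open>P\<close> is exact.\<close>

lemma area_diff:
  assumes P: "\<And>i. i \<in> {1..n} \<Longrightarrow> P i = p i + c"
    and len: "\<And>i. i \<in> {1..n} \<Longrightarrow> dist (X i) (X (nxt n i)) = dist (P i) (P (nxt n i))"
  shows "signed_area n X = signed_area n P + qform (\<lambda>i. X i - P i) (\<lambda>i. X i - P i) / 2"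
proof -
  define V where "V i = X i - P i" for i
  \<comment> \<open>A potential for the linear remainder: once the edge constraint is used, what is
    left on each edge is a difference of its end values.\<close>
  define f where "f i = (cross c (V i) - cross (p i) (V i)) / 2" for i
  have X: "X i = P i + V i" for i by (simp add: V_def)
  have term_eq: "(cross (X i) (X (nxt n i)) - cross (P i) (P (nxt n i))) / 2
     - ((cross (V i) (V (nxt n i)) + cross (V i) (V (nxt n i))) / 2
        - inner (V (nxt n i) - V i) (V (nxt n i) - V i) / (2 * tau i)) / 2
     = f (nxt n i) - f i" if i: "i \<in> {1..n}" for i
  proof -
    define v w where "v = V i" and "w = V (nxt n i)"
    define a b where "a = p i" and "b = p (nxt n i)"
    have ab: "b - a = tau i *\<^sub>R rot (a + b)"
      using tau_edge[OF i] by (simp add: a_def b_def)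
    have "(dist (X (nxt n i)) (X i))\<^sup>2 = (dist (P (nxt n i)) (P i))\<^sup>2"
      using len[OF i] by (simp add: dist_commute)
    moreover have "X (nxt n i) - X i = (b - a) + (w - v)" "P (nxt n i) - P i = b - a"
      using P i nxt_mem by (simp_all add: X a_def b_def v_def w_def)
    ultimately have "inner ((b - a) + (w - v)) ((b - a) + (w - v)) = inner (b - a) (b - a)"
      by (simp add: dist_norm power2_norm_eq_inner)
    \<comment> \<open>Constancy of the edge length trades the quadratic change of the edge for the
      linear one.\<close>
    then have "inner (w - v) (w - v) = - 2 * inner (b - a) (w - v)"
      by (simp only: inner_add_left inner_add_right inner_commute[of "w - v" "b - a"])
    also have "\<dots> = - 2 * tau i * cross (a + b) (w - v)"
      unfolding ab by (simp add: inner_rot_left)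
    finally have e: "inner (w - v) (w - v) / (2 * tau i) = - cross (a + b) (w - v)"
      using tau_nonzero[OF i] by (simp add: field_simps)
    show ?thesis
      unfolding f_def X P[OF i] P[OF nxt_mem] v_def[symmetric] w_def[symmetric]
        a_def[symmetric] b_def[symmetric] e
      by (simp add: cross_def field_simps)
  qed
  have "signed_area n X - signed_area n P - qform V V / 2
    = (\<Sum>i=1..n. (cross (X i) (X (nxt n i)) - cross (P i) (P (nxt n i))) / 2
     - ((cross (V i) (V (nxt n i)) + cross (V i) (V (nxt n i))) / 2
        - inner (V (nxt n i) - V i) (V (nxt n i) - V i) / (2 * tau i)) / 2)"
    unfolding signed_area_def qform_def sum_divide_distrib sum_subtractf[symmetric]
    by (intro sum.cong refl) (simp add: cross_def diff_divide_distrib mult.commute)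
  also have "\<dots> = (\<Sum>i=1..n. f (nxt n i) - f i)"
    by (intro sum.cong refl term_eq)
  also have "\<dots> = 0"
    using n_ge_3 by (intro sum_nxt_telescope) simp
  finally show ?thesis
    by (simp add: V_def[abs_def])
qed

text \<open>Write \<open>w\<close> in the frame \<open>a\<close>, \<open>rot a\<close> and
  \<open>z\<close> in the frame \<open>b\<close>, \<open>rot b\<close>; only radial and tangential
  components and the rotation between the frames then enter. The factors \<open>r\<close> clear
  denominators.\<close>

lemma polar_products:
  assumes "inner a a = r" "inner b b = r"
  shows "r * inner w b = inner w a * inner a b + cross a w * cross a b"
    and "r * r * cross w z = cross a b * (inner w a * inner z b + cross a w * cross b z)
      + inner a b * (inner w a * cross b z - cross a w * inner z b)"
    and "r * r * inner w z = inner a b * (inner w a * inner z b + cross a w * cross b z)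
      - cross a b * (inner w a * cross b z - cross a w * inner z b)"
proof -
  have w: "r *\<^sub>R w = inner w a *\<^sub>R a + cross a w *\<^sub>R rot a"
    using plane_decomp[of a w] assms by simp
  have z: "r *\<^sub>R z = inner z b *\<^sub>R b + cross b z *\<^sub>R rot b"
    using plane_decomp[of b z] assms by simp
  have "r * inner w b = inner (r *\<^sub>R w) b" by simp
  then show "r * inner w b = inner w a * inner a b + cross a w * cross a b"
    unfolding w by (simp add: inner_add_left inner_rot_left)
  have "r * r * cross w z = cross (r *\<^sub>R w) (r *\<^sub>R z)" by (simp add: cross_linear)
  then show "r * r * cross w z = cross a b * (inner w a * inner z b + cross a w * cross b z)
      + inner a b * (inner w a * cross b z - cross a w * inner z b)"
    unfolding w z
    by (simp add: cross_linear cross_rot_left cross_rot_right inner_rot_left inner_rot_right algebra_simps)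
  have "r * r * inner w z = inner (r *\<^sub>R w) (r *\<^sub>R z)" by simp
  then show "r * r * inner w z = inner a b * (inner w a * inner z b + cross a w * cross b z)
      - cross a b * (inner w a * cross b z - cross a w * inner z b)"
    unfolding w z
    by (simp add: inner_add_left inner_add_right inner_rot_rot
       inner_rot_left inner_rot_right cross_linear cross_rot_left algebra_simps)
qed

text \<open>The edge keeps its length to first order. Expanding each displacement against the other
  endpoint gives a relation between \<open>R\<^sup>2 - inner a b\<close> times the sum of the radial
  components and \<open>cross a b\<close> times the difference of the tangential ones; the quotient
  of the factors is \<open>tau i\<close>.\<close>

lemma tangent_edge:
  assumes i: "i \<in> {1..n}" and tan: "inner (w (nxt n i) - w i) (p (nxt n i) - p i) = 0"
  shows "cross (p (nxt n i)) (w (nxt n i))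
    = cross (p i) (w i) - tau i * (inner (w i) (p i) + inner (w (nxt n i)) (p (nxt n i)))"
proof -
  define a b u v where "a = p i" and "b = p (nxt n i)" and "u = w i" and "v = w (nxt n i)"
  have ab: "inner a a = R\<^sup>2" "inner b b = R\<^sup>2" and s0: "cross a b \<noteq> 0"
    using inner_p[OF i] inner_p[OF nxt_mem] cross_p[OF i] by (auto simp: a_def b_def)
  have "inner (v - u) (b - a) = 0"
    using tan by (simp add: a_def b_def u_def v_def)
  then have "R\<^sup>2 * (inner u a + inner v b) = R\<^sup>2 * inner u b + R\<^sup>2 * inner v a"
    by (simp add: inner_diff_left inner_diff_right algebra_simps flip: distrib_left)
  also have "\<dots> = inner a b * (inner u a + inner v b) + cross a b * (cross a u - cross b v)"
    unfolding polar_products(1)[OF ab] polar_products(1)[OF ab(2,1)]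
    by (simp add: inner_commute[of b a] cross_swap[of b a] algebra_simps)
  finally have "cross a b * (cross a u - cross b v) = (R\<^sup>2 - inner a b) * (inner u a + inner v b)"
    by (simp add: algebra_simps)
  also have "R\<^sup>2 - inner a b = cross a b * tau i"
    using s0 by (simp add: tau_def a_def b_def)
  finally have "cross a u - cross b v = tau i * (inner u a + inner v b)"
    using s0 by simp
  then show ?thesis
    by (simp add: a_def b_def u_def v_def)
qed

text \<open>Eliminating the tangential components at the far end leaves the summand of
  \<open>cform\<close> and a difference of end values, which cancels in the sum over the
  cycle.\<close>

lemma qform_edge:
  assumes i: "i \<in> {1..n}"
    and "inner (w (nxt n i) - w i) (p (nxt n i) - p i) = 0"
    and "inner (z (nxt n i) - z i) (p (nxt n i) - p i) = 0"
  defines "y \<equiv> \<lambda>i. inner (w i) (p i)" and "y' \<equiv> \<lambda>i. inner (z i) (p i)"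
    and "x \<equiv> \<lambda>i. cross (p i) (w i)" and "x' \<equiv> \<lambda>i. cross (p i) (z i)"
  shows "2 * R\<^sup>2 * ((cross (w i) (z (nxt n i)) + cross (z i) (w (nxt n i))) / 2
     - inner (w (nxt n i) - w i) (z (nxt n i) - z i) / (2 * tau i))
   = (tau i * (y i + y (nxt n i)) * (y' i + y' (nxt n i))
     - (y (nxt n i) - y i) * (y' (nxt n i) - y' i) / tau i)
     + ((x (nxt n i) * y' (nxt n i) + x' (nxt n i) * y (nxt n i)) - (x i * y' i + x' i * y i))"
proof -
  define r a b t where "r = R\<^sup>2" and "a = p i" and "b = p (nxt n i)" and "t = tau i"
  have ab: "inner a a = r" "inner b b = r" and r: "r > 0" and t0: "t \<noteq> 0"
    using inner_p[OF i] inner_p[OF nxt_mem] R_pos tau_nonzero[OF i]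
    by (auto simp: a_def b_def r_def t_def)
  have "1 + t\<^sup>2 \<noteq> 0"
    using zero_le_power2[of t] by linarith
  note t = t0 this
  have S: "cross a b = 2 * r * t / (1 + t\<^sup>2)" and C: "inner a b = r * (1 - t\<^sup>2) / (1 + t\<^sup>2)"
    using cross_eq_tau[OF i] by (simp_all add: a_def b_def t_def r_def)
  \<comment> \<open>Sine and cosine of the oriented central angle over the edge.\<close>
  define s c where "s = 2 * t / (1 + t\<^sup>2)" and "c = (1 - t\<^sup>2) / (1 + t\<^sup>2)"
  have st: "s = t * (1 + c)" "s * t = 1 - c"
    using t by (simp_all add: s_def c_def field_simps power2_eq_square)
  have S: "cross a b = r * s" and C: "inner a b = r * c"
    using S C by (simp_all add: s_def c_def)
  define X Y X' Y' where "X = x i" and "Y = y i" and "X' = x' i" and "Y' = y' i"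
  define X2 Y2 X2' Y2' where "X2 = x (nxt n i)" and "Y2 = y (nxt n i)"
    and "X2' = x' (nxt n i)" and "Y2' = y' (nxt n i)"
  note defs = X_def Y_def X'_def Y'_def X2_def Y2_def X2'_def Y2'_def x_def y_def x'_def y'_def
  have X2: "X2 = X - t * (Y + Y2)" and X2': "X2' = X' - t * (Y' + Y2')"
    using tangent_edge[OF i assms(2)] tangent_edge[OF i assms(3)] by (simp_all add: defs t_def)
  have r0: "r \<noteq> 0" using r by simp
  note pp = polar_products(2,3)[OF ab]
  have c1: "r * cross (w i) (z (nxt n i)) = s * (Y * Y2' + X * X2') + c * (Y * X2' - X * Y2')"
    and c2: "r * cross (z i) (w (nxt n i)) = s * (Y' * Y2 + X' * X2) + c * (Y' * X2 - X' * Y2)"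
    and i1: "r * inner (w i) (z (nxt n i)) = c * (Y * Y2' + X * X2') - s * (Y * X2' - X * Y2')"
    and i2: "r * inner (z i) (w (nxt n i)) = c * (Y' * Y2 + X' * X2) - s * (Y' * X2 - X' * Y2)"
    using pp[of "w i" "z (nxt n i)"] pp[of "z i" "w (nxt n i)"] r0 unfolding S C
    by (simp_all add: defs a_def b_def mult.assoc flip: distrib_left right_diff_distrib)
  have i3: "r * inner (w i) (z i) = Y * Y' + X * X'"
    using polar_products(3)[OF ab(1) ab(1), of "w i" "z i"] ab r0
    by (simp add: cross_self defs a_def mult.assoc)
  have i4: "r * inner (w (nxt n i)) (z (nxt n i)) = Y2 * Y2' + X2 * X2'"
    using polar_products(3)[OF ab(2) ab(2), of "w (nxt n i)" "z (nxt n i)"] ab r0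
    by (simp add: cross_self defs b_def mult.assoc)
  have "2 * r * ((cross (w i) (z (nxt n i)) + cross (z i) (w (nxt n i))) / 2
     - inner (w (nxt n i) - w i) (z (nxt n i) - z i) / (2 * t))
    = (r * cross (w i) (z (nxt n i)) + r * cross (z i) (w (nxt n i)))
      - (r * inner (w (nxt n i)) (z (nxt n i)) + r * inner (w i) (z i)
         - r * inner (w i) (z (nxt n i)) - r * inner (z i) (w (nxt n i))) / t"
    using t by (simp add: inner_diff_left inner_diff_right inner_commute[of "w (nxt n i)" "z i"] field_simps)
  also have "\<dots> = (t * (Y + Y2) * (Y' + Y2') - (Y2 - Y) * (Y2' - Y') / t)
     + ((X2 * Y2' + X2' * Y2) - (X * Y' + X' * Y))"
  proof -
    have c: "c = 1 - s * t"
      using st by simp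
    have k: "s * (1 + t * t) - 2 * t = 0"
      using t by (simp add: s_def power2_eq_square)
    \<comment> \<open>After elimination of \<open>X2\<close>, \<open>X2'\<close> and
      \<open>c\<close> the two sides differ by a multiple of the left-hand side of
      \<open>k\<close>.\<close>
    have "t * (s * (Y * Y2' + X * X2') + c * (Y * X2' - X * Y2')
        + (s * (Y' * Y2 + X' * X2) + c * (Y' * X2 - X' * Y2)))
      - (Y2 * Y2' + X2 * X2' + (Y * Y' + X * X')
        - (c * (Y * Y2' + X * X2') - s * (Y * X2' - X * Y2'))
        - (c * (Y' * Y2 + X' * X2) - s * (Y' * X2 - X' * Y2)))
      = t * (t * (Y + Y2) * (Y' + Y2') + ((X2 * Y2' + X2' * Y2) - (X * Y' + X' * Y)))
        - (Y2 - Y) * (Y2' - Y')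
        - ((Y * X2' - X * Y2') + (Y' * X2 - X' * Y2)) * (s * (1 + t * t) - 2 * t)"
      unfolding X2 X2' c by (simp add: algebra_simps)
    also have "\<dots> = t * (t * (Y + Y2) * (Y' + Y2') + ((X2 * Y2' + X2' * Y2) - (X * Y' + X' * Y)))
        - (Y2 - Y) * (Y2' - Y')"
      unfolding k by simp
    finally have "t * (s * (Y * Y2' + X * X2') + c * (Y * X2' - X * Y2')
        + (s * (Y' * Y2 + X' * X2) + c * (Y' * X2 - X' * Y2)))
      - (Y2 * Y2' + X2 * X2' + (Y * Y' + X * X')
        - (c * (Y * Y2' + X * X2') - s * (Y * X2' - X * Y2'))
        - (c * (Y' * Y2 + X' * X2) - s * (Y' * X2 - X' * Y2)))
      = t * (t * (Y + Y2) * (Y' + Y2') + ((X2 * Y2' + X2' * Y2) - (X * Y' + X' * Y)))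
        - (Y2 - Y) * (Y2' - Y')" .
    then show ?thesis
      unfolding c1 c2 i1 i2 i3 i4 using t by (simp add: field_simps)
  qed
  finally show ?thesis
    by (simp add: r_def t_def X_def Y_def X'_def Y'_def X2_def Y2_def X2'_def Y2'_def)
qed

text \<open>The end terms of \<open>qform_edge\<close> telescope, so on tangent vectors the radial
  components alone determine the form.\<close>

lemma qform_tangent:
  assumes "\<And>i. i \<in> {1..n} \<Longrightarrow> inner (w (nxt n i) - w i) (p (nxt n i) - p i) = 0"
    and "\<And>i. i \<in> {1..n} \<Longrightarrow> inner (z (nxt n i) - z i) (p (nxt n i) - p i) = 0"
  shows "2 * R\<^sup>2 * qform w z = cform (\<lambda>i. inner (w i) (p i)) (\<lambda>i. inner (z i) (p i))"
proof -
  define f where "f i = cross (p i) (w i) * inner (z i) (p i) + cross (p i) (z i) * inner (w i) (p i)"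
    for i
  have "2 * R\<^sup>2 * qform w z = cform (\<lambda>i. inner (w i) (p i)) (\<lambda>i. inner (z i) (p i))
     + (\<Sum>i=1..n. f (nxt n i) - f i)"
    unfolding qform_def cform_def sum_distrib_left sum.distrib[symmetric] f_def
    using assms by (intro sum.cong refl qform_edge) auto
  also have "(\<Sum>i=1..n. f (nxt n i) - f i) = 0"
    using n_ge_3 by (intro sum_nxt_telescope) simp
  finally show ?thesis by simp
qed

end

subsection \<open>The Hessian in local coordinates\<close>

lemma partial_deriv_const_on:
  assumes "openin (Euclidean_space d) U" "v \<in> U" "j < d" "\<And>x. x \<in> U \<Longrightarrow> f x = c"
  shows "partial_deriv j f v = 0"
  using assms(4) by (intro partial_deriv_eqI(2)[OF assms(1-3), of f "\<lambda>_. c"]) auto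

lemma moduli_space_edge_sq:
  assumes "X \<in> moduli_space n l" "i \<in> {1..n}"
  shows "inner (X (nxt n i) - X i) (X (nxt n i) - X i) = (l i)\<^sup>2"
proof -
  have "dist (X i) (X (nxt n i)) = l i"
    using assms by (simp add: moduli_space_def)
  then have "norm (X (nxt n i) - X i) = l i"
    by (metis dist_commute dist_norm)
  then show ?thesis
    by (simp flip: power2_norm_eq_inner)
qed

context inscribed_polygon
begin

text \<open>In the chart the area is exactly a constant plus half of \<open>qform\<close> of the
  displacement from \<open>P\<close>. This displacement is zero at \<open>u\<close>, so second
  derivatives of the chart drop out and the Hessian is the Gram matrix of \<open>qform\<close> on
  the coordinate tangent vectors \<open>w j\<close>.\<close>

lemma chart_hessian_sign:
  assumes P: "\<And>i. i \<in> {1..n} \<Longrightarrow> P i = p i + c"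
    and noncoll: "\<not> collinear (P ` {1..n})"
    and param: "local_param n l U \<phi>" and u: "u \<in> U" "\<phi> u = P"
  shows "sgn (Determinant.det (hessian (n - 3) (\<lambda>v. signed_area n (\<phi> v)) u))
    = - sgn (\<Sum>i=1..n. tau i) * (\<Prod>i=1..n. - sgn (cross (p i) (p (nxt n i))))"
proof -
  define m where "m = n - 3"
  define w where "w j i = partial_deriv j (\<lambda>v. \<phi> v i) u" for j i
  define y where "y j i = inner (w j i) (p i)" for j i
  have U: "openin (Euclidean_space m) U"
    and smooth: "\<And>i. i \<in> {1..n} \<Longrightarrow> smooth_on m U (\<lambda>u. \<phi> u i)"
    and immersion: "\<And>c. (\<And>i. i \<in> {1..n} \<Longrightarrow> (\<Sum>j<m. c j *\<^sub>R w j i) = 0) \<Longrightarrow> \<forall>j<m. c j = 0"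
    using param u(1) by (auto simp: local_param_def m_def w_def)
  have M: "\<phi> v \<in> moduli_space n l" if "v \<in> U" for v
    using param that by (auto simp: local_param_def dest: openin_imp_subset)
  have PM: "P \<in> moduli_space n l" using M u by auto
  have one_in: "1 \<in> {1..n}" "2 \<in> {1..n}" using n_ge_3 by auto
  have nxt1: "nxt n 1 = 2" using n_ge_3 by (simp add: nxt_def)

  have edge_const: "inner (\<phi> v (nxt n i) - \<phi> v i) (\<phi> v (nxt n i) - \<phi> v i) = (l i)\<^sup>2"
    if "v \<in> U" "i \<in> {1..n}" for v i
    by (rule moduli_space_edge_sq[OF M[OF that(1)] that(2)])

  have area: "signed_area n (\<phi> v) = signed_area n P + qform (\<lambda>i. \<phi> v i - P i) (\<lambda>i. \<phi> v i - P i) / 2"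
    if "v \<in> U" for v
    using M[OF that] PM by (intro area_diff[of P c]) (auto simp: P moduli_space_def)

  have d\<phi>: "((\<lambda>t. \<phi> (v(j := t)) i - P i) has_vector_derivative partial_deriv j (\<lambda>v. \<phi> v i) v) (at (v j))"
    if "v \<in> U" "j < m" "i \<in> {1..n}" for v j i
    using has_vector_derivative_diff[OF smooth_on_partial[OF smooth[OF that(3)] that(1,2)]
      has_vector_derivative_const[of "P i"]] by simp

  have first: "partial_deriv k (\<lambda>v. signed_area n (\<phi> v)) v
      = qform (\<lambda>i. \<phi> v i - P i) (\<lambda>i. partial_deriv k (\<lambda>v. \<phi> v i) v)"
    if v: "v \<in> U" and k: "k < m" for v k
  proof (rule partial_deriv_eqI(2)[OF U v k area])
    have "((\<lambda>t. qform (\<lambda>i. \<phi> (v(k := t)) i - P i) (\<lambda>i. \<phi> (v(k := t)) i - P i)) has_vector_derivative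
        qform (\<lambda>i. partial_deriv k (\<lambda>v. \<phi> v i) v) (\<lambda>i. \<phi> (v(k := v k)) i - P i)
        + qform (\<lambda>i. \<phi> (v(k := v k)) i - P i) (\<lambda>i. partial_deriv k (\<lambda>v. \<phi> v i) v)) (at (v k))"
      by (rule has_vector_derivative_qform) (rule d\<phi>[OF v k]; assumption)+
    then have "((\<lambda>t. signed_area n P + qform (\<lambda>i. \<phi> (v(k := t)) i - P i) (\<lambda>i. \<phi> (v(k := t)) i - P i) / 2)
        has_vector_derivative 0 + (qform (\<lambda>i. partial_deriv k (\<lambda>v. \<phi> v i) v) (\<lambda>i. \<phi> (v(k := v k)) i - P i)
        + qform (\<lambda>i. \<phi> (v(k := v k)) i - P i) (\<lambda>i. partial_deriv k (\<lambda>v. \<phi> v i) v)) / 2) (at (v k))"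
      by (intro has_vector_derivative_add has_vector_derivative_const has_vector_derivative_divide)
    then show "((\<lambda>t. signed_area n P + qform (\<lambda>i. \<phi> (v(k := t)) i - P i) (\<lambda>i. \<phi> (v(k := t)) i - P i) / 2)
        has_vector_derivative qform (\<lambda>i. \<phi> v i - P i) (\<lambda>i. partial_deriv k (\<lambda>v. \<phi> v i) v)) (at (v k))"
      by (simp add: qform_commute[of "\<lambda>i. partial_deriv k (\<lambda>v. \<phi> v i) v"])
  qed

  have second: "partial_deriv j (partial_deriv k (\<lambda>v. signed_area n (\<phi> v))) u = qform (w j) (w k)"
    if j: "j < m" and k: "k < m" for j k
  proof (rule partial_deriv_eqI(2)[OF U u(1) j first[OF _ k]])
    have "((\<lambda>t. qform (\<lambda>i. \<phi> (u(j := t)) i - P i) (\<lambda>i. partial_deriv k (\<lambda>v. \<phi> v i) (u(j := t))))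
        has_vector_derivative
        qform (\<lambda>i. partial_deriv j (\<lambda>v. \<phi> v i) u) (\<lambda>i. partial_deriv k (\<lambda>v. \<phi> v i) (u(j := u j)))
        + qform (\<lambda>i. \<phi> (u(j := u j)) i - P i) (\<lambda>i. partial_deriv j (partial_deriv k (\<lambda>v. \<phi> v i)) u)) (at (u j))"
    proof (rule has_vector_derivative_qform)
      fix i assume i: "i \<in> {1..n}"
      show "((\<lambda>t. \<phi> (u(j := t)) i - P i) has_vector_derivative partial_deriv j (\<lambda>v. \<phi> v i) u) (at (u j))"
        by (rule d\<phi>[OF u(1) j i])
      show "((\<lambda>t. partial_deriv k (\<lambda>v. \<phi> v i) (u(j := t))) has_vector_derivative
          partial_deriv j (partial_deriv k (\<lambda>v. \<phi> v i)) u) (at (u j))"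
        by (rule smooth_on_partial[OF smooth_on_partial_deriv[OF smooth[OF i] k] u(1) j])
    qed
    moreover have "qform (\<lambda>i. \<phi> (u(j := u j)) i - P i) z = 0" for z
      by (rule qform_zero_left) (simp add: u(2))
    ultimately show "((\<lambda>t. qform (\<lambda>i. \<phi> (u(j := t)) i - P i) (\<lambda>i. partial_deriv k (\<lambda>v. \<phi> v i) (u(j := t))))
        has_vector_derivative qform (w j) (w k)) (at (u j))"
      by (simp add: w_def[abs_def])
  qed

  \<comment> \<open>Half the derivative of the constant squared edge length.\<close>
  have tangent: "inner (w j (nxt n i) - w j i) (p (nxt n i) - p i) = 0"
    if j: "j < m" and i: "i \<in> {1..n}" for j i
  proof -
    let ?e = "\<lambda>v. \<phi> v (nxt n i) - \<phi> v i"
    have e: "((\<lambda>t. ?e (u(j := t))) has_vector_derivative w j (nxt n i) - w j i) (at (u j))"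
      unfolding w_def
      by (intro has_vector_derivative_diff smooth_on_partial[OF smooth u(1) j] i nxt_mem)
    have "((\<lambda>t. inner (?e (u(j := t))) (?e (u(j := t)))) has_vector_derivative
        inner (?e (u(j := u j))) (w j (nxt n i) - w j i)
        + inner (w j (nxt n i) - w j i) (?e (u(j := u j)))) (at (u j))"
      by (rule bounded_bilinear.has_vector_derivative[OF bounded_bilinear_inner e e])
    then have "partial_deriv j (\<lambda>v. inner (?e v) (?e v)) u
      = inner (?e u) (w j (nxt n i) - w j i) + inner (w j (nxt n i) - w j i) (?e u)"
      unfolding partial_deriv_def by (simp add: vector_derivative_at)
    moreover have "partial_deriv j (\<lambda>v. inner (?e v) (?e v)) u = 0"
      using edge_const i by (intro partial_deriv_const_on[OF U u(1) j])
    moreover have "?e u = p (nxt n i) - p i"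
      using P i nxt_mem u(2) by simp
    ultimately show ?thesis
      by (simp add: inner_commute)
  qed

  have pinned: "w j 1 = 0" "w j 2 = 0" if j: "j < m" for j
    unfolding w_def using M
    by (auto intro!: partial_deriv_const_on[OF U u(1) j] simp: moduli_space_def)

  have entry: "qform (w i) (w j) = 1 / (2 * R\<^sup>2) * cform (y i) (y j)" if "i < m" "j < m" for i j
    using qform_tangent[of "w i" "w j"] tangent that R_pos by (simp add: y_def[abs_def] field_simps)
  have hess: "hessian m (\<lambda>v. signed_area n (\<phi> v)) u
    = (1 / (2 * R\<^sup>2)) \<cdot>\<^sub>m Matrix.mat m m (\<lambda>(i, j). cform (y i) (y j))"
    unfolding hessian_def by (rule eq_matI) (auto simp: second entry)
  \<comment> \<open>Passing from \<open>qform\<close> to \<open>cform\<close> scales all entries by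
    one positive factor.\<close>
  have "sgn ((1 / (2 * R\<^sup>2)) ^ m) = 1"
    using R_pos by (intro sgn_pos) simp
  then have "sgn (Determinant.det (hessian m (\<lambda>v. signed_area n (\<phi> v)) u))
    = sgn (Determinant.det (Matrix.mat m m (\<lambda>(i, j). cform (y i) (y j))))"
    unfolding hess by (subst det_smult) (simp add: sgn_mult)
  also have "\<dots> = - sgn (\<Sum>i=1..n. tau i) * (\<Prod>i=1..n. - sgn (cross (p i) (p (nxt n i))))"
  proof -
    \<comment> \<open>The vector whose inner products with \<open>p 1\<close> and \<open>p 2\<close>
      are 1. If this held for all vertices, they would lie on a line.\<close>
    define a where "a = (1 / cross (p 1) (p 2)) *\<^sub>R (rot (p 1) - rot (p 2))"
    have "cross (p 1) (p 2) \<noteq> 0" using cross_p[OF one_in(1)] nxt1 by simp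
    then have a: "inner a (p 1) = 1" "inner a (p 2) = 1"
      using cross_swap[of "p 1" "p 2"] by (simp_all add: a_def inner_diff_left inner_rot_left cross_self)
    have "\<exists>i0\<in>{1..n}. inner a (p i0) \<noteq> 1"
    proof (rule ccontr)
      assume "\<not> ?thesis"
      then have "inner a x = 1 + inner a c" if "x \<in> P ` {1..n}" for x
        using that P by (auto simp: inner_add_right)
      moreover have "a \<noteq> 0" using a by auto
      ultimately show False
        using noncoll collinear_if_on_line by blast
    qed
    then obtain i0 where i0: "i0 \<in> {1..n}" "inner a (p i0) \<noteq> 1" by blast
    show ?thesis
      unfolding m_def
    proof (rule sgn_det_cform_tangent[OF a i0])
      fix j assume "j < n - 3"
      then have j: "j < m" by (simp add: m_def)
      show "y j 1 = 0" "y j 2 = 0"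
        using pinned[OF j] by (simp_all add: y_def)
      \<comment> \<open>By \<open>tangent_edge\<close> each summand is a difference of tangential
        components at the two ends of an edge.\<close>
      have "(\<Sum>i=1..n. tau i * (y j i + y j (nxt n i)))
        = (\<Sum>i=1..n. (- cross (p (nxt n i)) (w j (nxt n i))) - (- cross (p i) (w j i)))"
        by (intro sum.cong refl, subst tangent_edge) (auto simp: y_def tangent[OF j])
      also have "\<dots> = 0"
        using n_ge_3 by (intro sum_nxt_telescope) simp
      finally show "(\<Sum>i=1..n. tau i * (y j i + y j (nxt n i))) = 0" .
    next
      fix b and j
      assume b: "\<And>i. i \<in> {1..n} \<Longrightarrow> (\<Sum>j<n - 3. b j * y j i) = 0" and "j < n - 3"
      \<comment> \<open>If the radial components cancel in \<open>z\<close>, then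
        \<open>tangent_edge\<close> carries the tangential component 0 from the pinned vertex along
        the polygon. Hence \<open>z\<close> vanishes, and the immersion property applies.\<close>
      define z where "z i = (\<Sum>j<m. b j *\<^sub>R w j i)" for i
      have zy: "inner (z i) (p i) = 0" if "i \<in> {1..n}" for i
        using b[OF that] by (simp add: z_def inner_sum_left y_def m_def)
      have zt: "inner (z (nxt n i) - z i) (p (nxt n i) - p i) = 0" if "i \<in> {1..n}" for i
      proof -
        have "z (nxt n i) - z i = (\<Sum>j<m. b j *\<^sub>R (w j (nxt n i) - w j i))"
          by (simp add: z_def sum_subtractf scaleR_diff_right)
        then show ?thesis
          using tangent that by (simp add: inner_sum_left)
      qed
      have zx: "i \<in> {1..n} \<longrightarrow> cross (p i) (z i) = 0" for i
      proof (induction i)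
        case (Suc i)
        show ?case
        proof (cases "i = 0")
          case True
          then show ?thesis
            using pinned by (simp add: z_def cross_def)
        next
          case False
          show ?thesis
          proof
            assume "Suc i \<in> {1..n}"
            then have i: "i \<in> {1..n}" "nxt n i = Suc i"
              using False by (auto simp: nxt_less)
            then show "cross (p (Suc i)) (z (Suc i)) = 0"
              using tangent_edge[OF i(1) zt[OF i(1)]] zy[OF i(1)] zy[OF nxt_mem[of i]] Suc.IH by simp
          qed
        qed
      qed simp
      have "(\<Sum>j<m. b j *\<^sub>R w j i) = 0" if i: "i \<in> {1..n}" for i
        using plane_decomp[of "p i" "z i"] zy[OF i] zx i inner_p[OF i] R_pos by (simp add: z_def)
      then show "b j = 0"
        using immersion[of b] \<open>j < n - 3\<close> by (simp add: m_def)
    qed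
  qed
  finally show ?thesis
    by (simp add: m_def)
qed

end

subsection \<open>Closure properties of smooth functions\<close>

lemma Ck_on_imp_continuous_on: "Ck_on d k U f \<Longrightarrow> continuous_on U f"
  by (cases k) auto

lemma Ck_on_partial:
  "Ck_on d (Suc k) U f \<Longrightarrow> j < d \<Longrightarrow> v \<in> U \<Longrightarrow>
    ((\<lambda>t. f (v(j := t))) has_vector_derivative partial_deriv j f v) (at (v j))"
  by (simp add: partial_deriv_def vector_derivative_works[symmetric])

lemma Ck_on_partial_deriv: "Ck_on d (Suc k) U f \<Longrightarrow> j < d \<Longrightarrow> Ck_on d k U (partial_deriv j f)"
  by simp

lemma Ck_on_SucD: "Ck_on d (Suc k) U f \<Longrightarrow> Ck_on d k U f"
proof (induction k arbitrary: f)
  case (Suc k)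
  then show ?case by (metis Ck_on.simps(2))
qed simp

context
  fixes d :: nat and U :: "(nat \<Rightarrow> real) set"
  assumes U: "openin (Euclidean_space d) U"
begin

text \<open>On an open set partial derivatives depend only on the values there, so agreement passes
  to every order.\<close>

lemma Ck_on_cong:
  assumes "\<And>v. v \<in> U \<Longrightarrow> f v = g v" "Ck_on d k U f"
  shows "Ck_on d k U g"
  using assms
proof (induction k arbitrary: f g)
  case 0
  then show ?case using continuous_on_cong[of U U f g] by simp
next
  case (Suc k)
  have g: "((\<lambda>t. g (v(j := t))) has_vector_derivative partial_deriv j f v) (at (v j))"
    "partial_deriv j f v = partial_deriv j g v" if "j < d" "v \<in> U" for j v
    by (rule partial_deriv_eqI(1)[OF U that(2,1) Suc.prems(1)[symmetric] Ck_on_partial[OF Suc.prems(2) that]],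
        assumption,
        rule partial_deriv_eqI(2)[OF U that(2,1) Suc.prems(1)[symmetric] Ck_on_partial[OF Suc.prems(2) that], symmetric])
  moreover have "continuous_on U g"
    using Ck_on_imp_continuous_on[OF Suc.prems(2)] continuous_on_cong[of U U f g] Suc.prems(1) by simp
  moreover have "Ck_on d k U (partial_deriv j g)" if "j < d" for j
    using Suc.IH[OF g(2)[OF that] Ck_on_partial_deriv[OF Suc.prems(2) that]] .
  ultimately show ?case
    by (auto intro: differentiableI_vector)
qed

text \<open>Any formulas \<open>D j\<close> that give the partial derivatives on \<open>U\<close>
  suffice; they may differ from \<open>partial_deriv\<close> elsewhere.\<close>

lemma Ck_on_SucI:
  assumes "continuous_on U f"
    and D: "\<And>j v. j < d \<Longrightarrow> v \<in> U \<Longrightarrow> ((\<lambda>t. f (v(j := t))) has_vector_derivative D j v) (at (v j))"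
    and "\<And>j. j < d \<Longrightarrow> Ck_on d k U (D j)"
  shows "Ck_on d (Suc k) U f"
proof -
  have "partial_deriv j f v = D j v" if "j < d" "v \<in> U" for j v
    unfolding partial_deriv_def by (rule vector_derivative_at[OF D[OF that]])
  then have "Ck_on d k U (partial_deriv j f)" if "j < d" for j
    using Ck_on_cong[of "D j" "partial_deriv j f" k] assms(3) that by simp
  then show ?thesis
    using assms(1) D by (auto intro: differentiableI_vector)
qed

lemma Ck_on_const: "Ck_on d k U (\<lambda>_. c)"
proof (induction k arbitrary: c)
  case (Suc k)
  show ?case
    by (rule Ck_on_SucI[where D = "\<lambda>_ _. 0"]) (simp_all add: Suc)
qed simp

lemma Ck_on_coord: "Ck_on d k U (\<lambda>u. u i)"
proof (cases k)
  case 0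
  then show ?thesis
    by (simp add: continuous_on_subset[OF continuous_on_product_coordinates])
next
  case (Suc k')
  have "((\<lambda>t. (v(j := t)) i) has_vector_derivative (if i = j then 1 else 0)) (at (v j))" for v j
    by (cases "i = j") auto
  then show ?thesis
    unfolding Suc
    by (intro Ck_on_SucI[where D = "\<lambda>j _. if i = j then 1 else 0"] Ck_on_const
        continuous_on_subset[OF continuous_on_product_coordinates subset_UNIV])
qed

lemma Ck_on_linear:
  assumes "bounded_linear L" "Ck_on d k U f"
  shows "Ck_on d k U (\<lambda>u. L (f u))"
  using assms(2)
proof (induction k arbitrary: f)
  case 0
  then show ?case using bounded_linear.continuous_on[OF assms(1)] by simp
next
  case (Suc k)
  show ?case
  proof (rule Ck_on_SucI)
    show "continuous_on U (\<lambda>u. L (f u))"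
      using Ck_on_imp_continuous_on[OF Suc.prems] by (rule bounded_linear.continuous_on[OF assms(1)])
    show "((\<lambda>t. L (f (v(j := t)))) has_vector_derivative L (partial_deriv j f v)) (at (v j))"
      if "j < d" "v \<in> U" for j v
      by (rule bounded_linear.has_vector_derivative[OF assms(1) Ck_on_partial[OF Suc.prems that]])
    show "Ck_on d k U (\<lambda>v. L (partial_deriv j f v))" if "j < d" for j
      by (rule Suc.IH[OF Ck_on_partial_deriv[OF Suc.prems that]])
  qed
qed

lemma Ck_on_add:
  assumes "Ck_on d k U f" "Ck_on d k U g"
  shows "Ck_on d k U (\<lambda>u. f u + g u)"
  using assms
proof (induction k arbitrary: f g)
  case 0
  then show ?case by (simp add: continuous_on_add)
next
  case (Suc k)
  show ?case
  proof (rule Ck_on_SucI)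
    show "continuous_on U (\<lambda>u. f u + g u)"
      by (intro continuous_on_add Ck_on_imp_continuous_on[OF Suc.prems(1)] Ck_on_imp_continuous_on[OF Suc.prems(2)])
    show "((\<lambda>t. f (v(j := t)) + g (v(j := t))) has_vector_derivative
        partial_deriv j f v + partial_deriv j g v) (at (v j))" if "j < d" "v \<in> U" for j v
      by (intro has_vector_derivative_add Ck_on_partial[OF Suc.prems(1) that] Ck_on_partial[OF Suc.prems(2) that])
    show "Ck_on d k U (\<lambda>v. partial_deriv j f v + partial_deriv j g v)" if "j < d" for j
      by (intro Suc.IH Ck_on_partial_deriv[OF Suc.prems(1) that] Ck_on_partial_deriv[OF Suc.prems(2) that])
  qed
qed

text \<open>The product rule pairs one function with a derivative of the other, hence the induction
  varies both functions.\<close>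

lemma Ck_on_bilinear:
  assumes B: "bounded_bilinear B" and "Ck_on d k U f" "Ck_on d k U g"
  shows "Ck_on d k U (\<lambda>u. B (f u) (g u))"
  using assms(2,3)
proof (induction k arbitrary: f g)
  case 0
  then show ?case by (simp add: bounded_bilinear.continuous_on[OF B])
next
  case (Suc k)
  note f = Suc.prems(1) and g = Suc.prems(2)
  show ?case
  proof (rule Ck_on_SucI)
    show "continuous_on U (\<lambda>u. B (f u) (g u))"
      by (intro bounded_bilinear.continuous_on[OF B] Ck_on_imp_continuous_on[OF f] Ck_on_imp_continuous_on[OF g])
    show "((\<lambda>t. B (f (v(j := t))) (g (v(j := t)))) has_vector_derivative
        B (f v) (partial_deriv j g v) + B (partial_deriv j f v) (g v)) (at (v j))"
      if "j < d" "v \<in> U" for j v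
      using bounded_bilinear.has_vector_derivative[OF B Ck_on_partial[OF f that] Ck_on_partial[OF g that]]
      unfolding fun_upd_triv .
    show "Ck_on d k U (\<lambda>v. B (f v) (partial_deriv j g v) + B (partial_deriv j f v) (g v))"
      if "j < d" for j
      by (intro Ck_on_add Suc.IH Ck_on_SucD[OF f] Ck_on_SucD[OF g]
          Ck_on_partial_deriv[OF f that] Ck_on_partial_deriv[OF g that])
  qed
qed

text \<open>The derivative is a product of the inverse itself and a partial derivative of
  \<open>f\<close>, both available one order lower.\<close>

lemma Ck_on_inverse:
  fixes f :: "(nat \<Rightarrow> real) \<Rightarrow> real"
  assumes nz: "\<And>u. u \<in> U \<Longrightarrow> f u \<noteq> 0" and "Ck_on d k U f"
  shows "Ck_on d k U (\<lambda>u. inverse (f u))"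
  using assms(2)
proof (induction k)
  case 0
  then show ?case using nz by (simp add: continuous_on_inverse)
next
  case (Suc k)
  note f = Suc.prems
  show ?case
  proof (rule Ck_on_SucI)
    show "continuous_on U (\<lambda>u. inverse (f u))"
      using nz by (intro continuous_on_inverse Ck_on_imp_continuous_on[OF f]) auto
    show "((\<lambda>t. inverse (f (v(j := t)))) has_vector_derivative
        (-1) * (inverse (f v) * partial_deriv j f v * inverse (f v))) (at (v j))"
      if "j < d" "v \<in> U" for j v
    proof -
      have "((\<lambda>t. f (v(j := t))) has_real_derivative partial_deriv j f v) (at (v j))"
        unfolding has_real_derivative_iff_has_vector_derivative by (rule Ck_on_partial[OF f that])
      then have "((\<lambda>t. inverse (f (v(j := t)))) has_real_derivative
          - (inverse (f (v(j := v j))) * partial_deriv j f v * inverse (f (v(j := v j))))) (at (v j))"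
        by (rule DERIV_inverse') (simp add: nz that)
      then show ?thesis
        unfolding has_real_derivative_iff_has_vector_derivative fun_upd_triv by simp
    qed
    show "Ck_on d k U (\<lambda>v. (-1) * (inverse (f v) * partial_deriv j f v * inverse (f v)))"
      if "j < d" for j
      by (intro Ck_on_bilinear[OF bounded_bilinear_mult] Ck_on_const Suc.IH Ck_on_SucD[OF f]
          Ck_on_partial_deriv[OF f that])
  qed
qed

lemma Ck_on_sqrt:
  fixes f :: "(nat \<Rightarrow> real) \<Rightarrow> real"
  assumes pos: "\<And>u. u \<in> U \<Longrightarrow> f u > 0" and "Ck_on d k U f"
  shows "Ck_on d k U (\<lambda>u. sqrt (f u))"
  using assms(2)
proof (induction k)
  case 0
  then show ?case by (simp add: continuous_on_real_sqrt)
next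
  case (Suc k)
  note f = Suc.prems
  show ?case
  proof (rule Ck_on_SucI)
    show "continuous_on U (\<lambda>u. sqrt (f u))"
      by (intro continuous_on_real_sqrt Ck_on_imp_continuous_on[OF f])
    show "((\<lambda>t. sqrt (f (v(j := t)))) has_vector_derivative
        (1 / 2) * inverse (sqrt (f v)) * partial_deriv j f v) (at (v j))"
      if "j < d" "v \<in> U" for j v
    proof -
      have "((\<lambda>t. f (v(j := t))) has_real_derivative partial_deriv j f v) (at (v j))"
        unfolding has_real_derivative_iff_has_vector_derivative by (rule Ck_on_partial[OF f that])
      then have "((\<lambda>t. sqrt (f (v(j := t)))) has_real_derivative
          inverse (sqrt (f (v(j := v j)))) / 2 * partial_deriv j f v) (at (v j))"
        by (rule DERIV_chain2[OF DERIV_real_sqrt, rotated]) (simp add: pos that)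
      then show ?thesis
        unfolding has_real_derivative_iff_has_vector_derivative fun_upd_triv by simp
    qed
    show "Ck_on d k U (\<lambda>v. (1 / 2) * inverse (sqrt (f v)) * partial_deriv j f v)"
      if "j < d" for j
      using pos
      by (intro Ck_on_bilinear[OF bounded_bilinear_mult] Ck_on_const Ck_on_inverse Suc.IH Ck_on_SucD[OF f]
          Ck_on_partial_deriv[OF f that]) (metis real_sqrt_gt_zero less_irrefl)
  qed
qed

lemma smooth_on_const: "smooth_on d U (\<lambda>_. c)"
  and smooth_on_coord: "smooth_on d U (\<lambda>u. u i)"
  and smooth_on_linear: "bounded_linear L \<Longrightarrow> smooth_on d U F \<Longrightarrow> smooth_on d U (\<lambda>u. L (F u))"
  and smooth_on_add: "smooth_on d U F \<Longrightarrow> smooth_on d U G \<Longrightarrow> smooth_on d U (\<lambda>u. F u + G u)"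
  and smooth_on_bilinear: "bounded_bilinear B \<Longrightarrow> smooth_on d U F' \<Longrightarrow> smooth_on d U G' \<Longrightarrow>
    smooth_on d U (\<lambda>u. B (F' u) (G' u))"
  and smooth_on_inverse: "(\<And>u. u \<in> U \<Longrightarrow> f u \<noteq> 0) \<Longrightarrow> smooth_on d U f \<Longrightarrow>
    smooth_on d U (\<lambda>u. inverse (f u) :: real)"
  and smooth_on_sqrt: "(\<And>u. u \<in> U \<Longrightarrow> f u > 0) \<Longrightarrow> smooth_on d U f \<Longrightarrow>
    smooth_on d U (\<lambda>u. sqrt (f u))"
  unfolding smooth_on_def
  by (simp_all add: Ck_on_const Ck_on_coord Ck_on_linear Ck_on_add Ck_on_bilinear Ck_on_inverse Ck_on_sqrt)

lemmas smooth_on_scaleR = smooth_on_bilinear[OF bounded_bilinear_scaleR]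
lemmas smooth_on_mult = smooth_on_bilinear[OF bounded_bilinear_mult]
lemmas smooth_on_minus = smooth_on_linear[OF bounded_linear_minus[OF bounded_linear_ident]]

lemma smooth_on_diff: "smooth_on d U f \<Longrightarrow> smooth_on d U g \<Longrightarrow> smooth_on d U (\<lambda>u. f u - g u)"
  using smooth_on_add[OF _ smooth_on_minus, of f g] by simp

lemma smooth_on_power2: "smooth_on d U f \<Longrightarrow> smooth_on d U (\<lambda>u. (f u)\<^sup>2 :: real)"
  using smooth_on_mult[of f f] by (simp add: power2_eq_square)

lemma smooth_on_sum: "(\<And>k. k \<in> K \<Longrightarrow> smooth_on d U (f k)) \<Longrightarrow> smooth_on d U (\<lambda>u. \<Sum>k\<in>K. f k u)"
  by (induction K rule: infinite_finite_induct) (simp_all add: smooth_on_const smooth_on_add)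

end

lemma smooth_on_imp_continuous_on: "smooth_on d U f \<Longrightarrow> continuous_on U f"
  using Ck_on_imp_continuous_on unfolding smooth_on_def by blast

subsection \<open>Existence of local coordinates\<close>

lemma vertex_eq_sum_edges:
  fixes X :: "nat \<Rightarrow> point"
  assumes "X 1 = 0" "i \<in> {1..n}"
  shows "(\<Sum>k=1..<i. X (nxt n k) - X k) = X i"
  using assms(2)
proof (induction i)
  case (Suc i)
  show ?case
  proof (cases "i = 0")
    case False
    then have "i \<in> {1..n}" "nxt n i = Suc i"
      using Suc.prems by (auto simp: nxt_less)
    then show ?thesis
      using Suc.IH False by simp
  qed (use assms(1) in simp)
qed simp

lemma bounded_linear_rot: "bounded_linear rot"
  unfolding linear_conv_bounded_linear[symmetric]
  by (rule linearI) (simp_all add: rot_add rot_scaleR)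

text \<open>The edges other than \<open>1\<close>, \<open>a\<close>, \<open>b\<close> are turned freely, and the edges \<open>a\<close> and \<open>b\<close> close up the
  polygon; the sign of the cross product selects one of the two solutions.\<close>

locale two_link_chart =
  fixes n :: nat and l :: "nat \<Rightarrow> real" and P :: "nat \<Rightarrow> point" and a b :: nat and h :: "nat \<Rightarrow> nat"
  assumes n_ge_3: "n \<ge> 3" and l_pos: "\<And>i. i \<in> {1..n} \<Longrightarrow> l i > 0"
    and P_in: "P \<in> moduli_space n l"
    and ab: "a \<in> {2..n}" "b \<in> {2..n}" "a \<noteq> b"
    and cross_ab: "cross (P (nxt n a) - P a) (P (nxt n b) - P b) < 0"
    and h: "bij_betw h {..<n - 3} ({2..n} - {a, b})"
begin

section \<open>The two-link chart and its inverse\<close>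

definition E :: "nat \<Rightarrow> point" where
  "E k = P (nxt n k) - P k"

definition F :: "nat set" where
  "F = {2..n} - {a, b}"

definition idx :: "nat \<Rightarrow> nat" where
  "idx = inv_into {..<n - 3} h"

text \<open>The coordinate is the sine of the angle by which the edge of \<open>P\<close> is turned;
  the nonnegative root keeps the turn below a right angle on \<open>chart_dom\<close>.\<close>

definition free_edge :: "(nat \<Rightarrow> real) \<Rightarrow> nat \<Rightarrow> point" where
  "free_edge u k = sqrt (1 - (u (idx k))\<^sup>2) *\<^sub>R E k + u (idx k) *\<^sub>R rot (E k)"

text \<open>The sum that the edges \<open>a\<close> and \<open>b\<close> must have for the polygon
  to close.\<close>

definition W :: "(nat \<Rightarrow> real) \<Rightarrow> point" where
  "W u = - (E 1 + (\<Sum>k\<in>F. free_edge u k))"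

text \<open>Heron's formula: 16 times the squared area of the triangle with sides
  \<open>l a\<close>, \<open>l b\<close> and the length of \<open>W u\<close>.\<close>

definition discr :: "(nat \<Rightarrow> real) \<Rightarrow> real" where
  "discr u = 4 * (l a)\<^sup>2 * inner (W u) (W u) - (inner (W u) (W u) + (l a)\<^sup>2 - (l b)\<^sup>2)\<^sup>2"

text \<open>The law of cosines gives the component along \<open>W u\<close>, the area of the
  triangle the orthogonal one. The plus sign selects the solution in which the cross product of the
  edges \<open>a\<close> and \<open>b\<close> is negative.\<close>

definition edge_a :: "(nat \<Rightarrow> real) \<Rightarrow> point" where
  "edge_a u = ((inner (W u) (W u) + (l a)\<^sup>2 - (l b)\<^sup>2) * inverse (2 * inner (W u) (W u))) *\<^sub>R W u
    + (sqrt (discr u) * inverse (2 * inner (W u) (W u))) *\<^sub>R rot (W u)"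

definition edge :: "(nat \<Rightarrow> real) \<Rightarrow> nat \<Rightarrow> point" where
  "edge u k = (if k = 1 then E 1 else if k = a then edge_a u else if k = b then W u - edge_a u
    else free_edge u k)"

definition chart :: "(nat \<Rightarrow> real) \<Rightarrow> nat \<Rightarrow> point" where
  "chart u i = (if i \<in> {1..n} then \<Sum>k=1..<i. edge u k else 0)"

definition chart_dom :: "(nat \<Rightarrow> real) set" where
  "chart_dom = {u. (\<forall>i\<ge>n - 3. u i = 0) \<and> (\<forall>j<n - 3. (u j)\<^sup>2 < 1) \<and> 0 < discr u}"

text \<open>The sines of the turning angles, read off the edges. The value 0 from
  \<open>n - 3\<close> on is the one required in \<open>Euclidean_space\<close>.\<close>

definition coords :: "(nat \<Rightarrow> point) \<Rightarrow> nat \<Rightarrow> real" where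
  "coords X j = (if j < n - 3 then cross (E (h j)) (X (nxt n (h j)) - X (h j)) / (l (h j))\<^sup>2 else 0)"

text \<open>Open conditions under which the sines determine the configuration: positive cosines of
  the turning angles, and the two links bent to the same side as in \<open>P\<close>.\<close>

definition chart_ran :: "(nat \<Rightarrow> point) set" where
  "chart_ran = {X \<in> moduli_space n l. (\<forall>j<n - 3. 0 < inner (E (h j)) (X (nxt n (h j)) - X (h j)))
     \<and> cross (X (nxt n a) - X a) (X (nxt n b) - X b) < 0}"

lemma h_in: "j < n - 3 \<Longrightarrow> h j \<in> F"
  and idx_h: "j < n - 3 \<Longrightarrow> idx (h j) = j"
  and idx_less: "k \<in> F \<Longrightarrow> idx k < n - 3"
  and h_idx: "k \<in> F \<Longrightarrow> h (idx k) = k"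
proof -
  note b = h[folded F_def]
  show "j < n - 3 \<Longrightarrow> h j \<in> F" using bij_betwE[OF b] by simp
  show "j < n - 3 \<Longrightarrow> idx (h j) = j"
    unfolding idx_def using bij_betw_inv_into_left[OF b] by simp
  show "k \<in> F \<Longrightarrow> idx k < n - 3"
    unfolding idx_def using bij_betwE[OF bij_betw_inv_into[OF b]] by simp
  show "k \<in> F \<Longrightarrow> h (idx k) = k"
    unfolding idx_def using bij_betw_inv_into_right[OF b] by simp
qed

lemma F_subset: "k \<in> F \<Longrightarrow> k \<in> {1..n} \<and> k \<noteq> 1 \<and> k \<noteq> a \<and> k \<noteq> b"
  by (auto simp: F_def)

lemma ab_in: "a \<in> {1..n}" "b \<in> {1..n}" "a \<noteq> 1" "b \<noteq> 1"
  using ab by auto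

lemma nxt_mem: "nxt n i \<in> {1..n}"
  using n_ge_3 by (intro nxt_in) simp

lemma sum_edges_split: "(\<Sum>k=1..n. f k) = f 1 + (\<Sum>k\<in>F. f k) + f a + (f b :: point)"
proof -
  have "{1..n} = insert 1 (insert a (insert b F))"
    using ab n_ge_3 by (auto simp: F_def)
  moreover have "1 \<notin> F" "a \<notin> F" "b \<notin> F" "finite F"
    by (auto simp: F_def)
  ultimately show ?thesis
    using ab by (simp add: add_ac)
qed

lemma moduli_edges:
  assumes "X \<in> moduli_space n l"
  shows "X (nxt n 1) - X 1 = E 1"
    and "(X (nxt n 1) - X 1) + (\<Sum>k\<in>F. X (nxt n k) - X k) + (X (nxt n a) - X a) + (X (nxt n b) - X b) = 0"
    and "X 1 = 0"
proof -
  have "nxt n 1 = 2" using n_ge_3 by (simp add: nxt_def)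
  then show "X (nxt n 1) - X 1 = E 1"
    using assms P_in by (simp add: E_def moduli_space_def)
  show "X 1 = 0"
    using assms by (simp add: moduli_space_def zero_prod_def)
  have "(\<Sum>k=1..n. X (nxt n k) - X k) = 0"
    using sum_nxt[of n X] n_ge_3 by (simp add: sum_subtractf)
  then show "(X (nxt n 1) - X 1) + (\<Sum>k\<in>F. X (nxt n k) - X k) + (X (nxt n a) - X a) + (X (nxt n b) - X b) = 0"
    using sum_edges_split[of "\<lambda>k. X (nxt n k) - X k"] by simp
qed

lemma inner_E: "k \<in> {1..n} \<Longrightarrow> inner (E k) (E k) = (l k)\<^sup>2"
  unfolding E_def by (rule moduli_space_edge_sq[OF P_in])

text \<open>For \<open>W u = 0\<close> the discriminant would be minus a square.\<close>

lemma W_pos: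
  assumes "u \<in> chart_dom"
  shows "inner (W u) (W u) > 0"
proof (rule ccontr)
  assume "\<not> ?thesis"
  then have "inner (W u) (W u) = 0"
    using inner_ge_zero[of "W u"] by linarith
  then show False
    using assms by (simp add: chart_dom_def discr_def)
qed

lemma edge_free: "k \<in> F \<Longrightarrow> edge u k = free_edge u k"
  using F_subset by (auto simp: edge_def)

lemma edge_ab: "edge u a = edge_a u" "edge u b = W u - edge_a u" "edge u 1 = E 1"
  using ab ab_in by (auto simp: edge_def)

text \<open>For \<open>k = n\<close> the edge runs back to vertex 1; it is correct because the
  choice of \<open>W\<close> makes all edges add up to zero.\<close>

lemma chart_edge:
  assumes "k \<in> {1..n}"
  shows "chart u (nxt n k) - chart u k = edge u k"
proof (cases "k = n")
  case True
  have "(\<Sum>k=1..n. edge u k) = E 1 + (\<Sum>k\<in>F. free_edge u k) + W u"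
    unfolding sum_edges_split edge_ab by (simp add: edge_free)
  also have "\<dots> = 0"
    by (simp add: W_def)
  finally have "(\<Sum>k=1..<n. edge u k) + edge u n = 0"
    using n_ge_3 by (simp add: atLeastLessThanSuc_atLeastAtMost[symmetric])
  then show ?thesis
    using True n_ge_3 by (simp add: nxt_self chart_def algebra_simps add_eq_0_iff)
next
  case False
  then show ?thesis
    using assms by (simp add: nxt_less chart_def)
qed

lemma free_edge_inner:
  assumes "u \<in> chart_dom" "k \<in> F"
  shows "inner (free_edge u k) (free_edge u k) = (l k)\<^sup>2"
    and "inner (E k) (free_edge u k) = sqrt (1 - (u (idx k))\<^sup>2) * (l k)\<^sup>2"
    and "cross (E k) (free_edge u k) = u (idx k) * (l k)\<^sup>2"
proof -
  have "(u (idx k))\<^sup>2 < 1"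
    using assms idx_less by (auto simp: chart_dom_def)
  moreover have "inner (E k) (E k) = (l k)\<^sup>2"
    using assms F_subset inner_E by blast
  ultimately show "inner (free_edge u k) (free_edge u k) = (l k)\<^sup>2"
    and "inner (E k) (free_edge u k) = sqrt (1 - (u (idx k))\<^sup>2) * (l k)\<^sup>2"
    and "cross (E k) (free_edge u k) = u (idx k) * (l k)\<^sup>2"
    by (simp_all add: free_edge_def inner_add_left inner_add_right inner_rot_left inner_rot_right
        inner_rot_rot cross_self cross_linear cross_rot_left cross_rot_right algebra_simps
        flip: power2_eq_square)
qed

text \<open>Pythagoras in the frame \<open>W u\<close>, \<open>rot (W u)\<close>; the positive
  coefficient of \<open>rot (W u)\<close> fixes the sign of the cross product.\<close>

lemma edge_a_inner:
  assumes "u \<in> chart_dom"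
  shows "inner (edge_a u) (edge_a u) = (l a)\<^sup>2"
    and "inner (W u - edge_a u) (W u - edge_a u) = (l b)\<^sup>2"
    and "cross (edge_a u) (W u - edge_a u) < 0"
proof -
  define w where "w = inner (W u) (W u)"
  define q where "q = w + (l a)\<^sup>2 - (l b)\<^sup>2"
  define s where "s = sqrt (discr u)"
  have w: "w > 0" using W_pos[OF assms] by (simp add: w_def)
  have s: "s > 0" "s\<^sup>2 = 4 * (l a)\<^sup>2 * w - q\<^sup>2"
    using assms by (simp_all add: s_def chart_dom_def discr_def q_def w_def)
  have e: "edge_a u = (q / (2 * w)) *\<^sub>R W u + (s / (2 * w)) *\<^sub>R rot (W u)"
    unfolding edge_a_def q_def w_def s_def divide_inverse ..
  have "inner (edge_a u) (edge_a u) = (q / (2 * w))\<^sup>2 * w + (s / (2 * w))\<^sup>2 * w"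
    by (simp add: e inner_add_left inner_add_right inner_rot_left inner_rot_right inner_rot_rot
        cross_self cross_linear cross_rot_left w_def power2_eq_square)
  also have "\<dots> = (q\<^sup>2 + s\<^sup>2) / (4 * w)"
    using w by (simp add: field_simps power2_eq_square)
  also have "\<dots> = (l a)\<^sup>2"
    using w s by simp
  finally show 1: "inner (edge_a u) (edge_a u) = (l a)\<^sup>2" .
  have "inner (W u) (edge_a u) = q / 2"
    using w by (simp add: e inner_add_right inner_rot_right cross_self w_def[symmetric])
  then show "inner (W u - edge_a u) (W u - edge_a u) = (l b)\<^sup>2"
    using 1 by (simp add: inner_diff_left inner_diff_right inner_commute[of "edge_a u" "W u"] w_def[symmetric] q_def)
  have "cross (edge_a u) (W u - edge_a u) = cross (edge_a u) (W u)"
    by (simp add: cross_linear cross_self)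
  also have "\<dots> = - s / 2"
    using w by (simp add: e cross_linear cross_self cross_rot_left w_def[symmetric])
  finally show "cross (edge_a u) (W u - edge_a u) < 0"
    using s by simp
qed

lemma chart_in_ran:
  assumes u: "u \<in> chart_dom"
  shows "chart u \<in> chart_ran"
proof -
  have len: "dist (chart u k) (chart u (nxt n k)) = l k" if k: "k \<in> {1..n}" for k
  proof -
    have "inner (edge u k) (edge u k) = (l k)\<^sup>2"
    proof -
      have "k = 1 \<or> k = a \<or> k = b \<or> k \<in> F" using k by (auto simp: F_def)
      then show ?thesis
      proof (elim disjE)
        assume "k = 1"
        then show ?thesis
          using inner_E[OF k] by (simp only: edge_ab)
      qed (simp_all only: edge_ab edge_free edge_a_inner[OF u] free_edge_inner(1)[OF u])
    qed
    then have "norm (edge u k) = l k"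
      using l_pos[OF k] by (simp add: norm_eq_sqrt_inner)
    then show ?thesis
      using chart_edge[OF k, of u] by (metis dist_commute dist_norm)
  qed
  have "nxt n 1 = 2" using n_ge_3 by (simp add: nxt_def)
  then have E1: "E 1 = (0, l 1)"
    using P_in by (simp add: E_def moduli_space_def)
  have "chart u 1 = (0, 0)"
    using n_ge_3 by (simp add: chart_def zero_prod_def)
  moreover have "chart u 2 = (0, l 1)"
    using n_ge_3 E1 edge_ab(3)[of u] by (simp add: chart_def numeral_2_eq_2)
  ultimately have M: "chart u \<in> moduli_space n l"
    using len by (simp add: moduli_space_def chart_def)
  have pos: "0 < inner (E (h j)) (chart u (nxt n (h j)) - chart u (h j))" if j: "j < n - 3" for j
  proof -
    have "h j \<in> {1..n}" using h_in[OF j] F_subset by blast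
    moreover have "(u j)\<^sup>2 < 1" using u j by (simp add: chart_dom_def)
    ultimately show ?thesis
      using l_pos[of "h j"] free_edge_inner(2)[OF u h_in[OF j]]
      by (simp add: chart_edge edge_free h_in[OF j] idx_h[OF j])
  qed
  show ?thesis
    using M pos edge_a_inner(3)[OF u] ab_in by (simp add: chart_ran_def chart_edge edge_ab)
qed

lemma coords_chart:
  assumes u: "u \<in> chart_dom"
  shows "coords (chart u) = u"
proof
  fix j show "coords (chart u) j = u j"
  proof (cases "j < n - 3")
    case True
    have k: "h j \<in> {1..n}" using h_in[OF True] F_subset by blast
    show ?thesis
      using True l_pos[OF k] free_edge_inner(3)[OF u h_in[OF True]]
      by (simp add: coords_def chart_edge[OF k] edge_free h_in[OF True] idx_h[OF True])
  next
    case False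
    then show ?thesis using u by (simp add: coords_def chart_dom_def)
  qed
qed

text \<open>A free edge is recovered from its sine because its cosine is positive. The edges
  \<open>a\<close> and \<open>b\<close> add up to \<open>W u\<close>; the law of cosines fixes the
  component of edge \<open>a\<close> along \<open>W u\<close>, and the orientation fixes the sign of
  the orthogonal one.\<close>

lemma chart_coords:
  assumes X: "X \<in> chart_ran"
  shows "coords X \<in> chart_dom" and "chart (coords X) = X"
proof -
  define f where "f k = X (nxt n k) - X k" for k
  define u where "u = coords X"
  have M: "X \<in> moduli_space n l" using X by (simp add: chart_ran_def)
  have ff: "inner (f k) (f k) = (l k)\<^sup>2" if "k \<in> {1..n}" for k
    unfolding f_def by (rule moduli_space_edge_sq[OF M that])
  have free: "(u (idx k))\<^sup>2 < 1 \<and> free_edge u k = f k" if k: "k \<in> F" for k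
  proof -
    have k': "k \<in> {1..n}" using F_subset[OF k] by simp
    define L where "L = (l k)\<^sup>2"
    have L: "L > 0" using l_pos[OF k'] by (simp add: L_def)
    define s where "s = u (idx k)"
    define c where "c = inner (E k) (f k) / L"
    have cpos: "c > 0"
      using X idx_less[OF k] L h_idx[OF k] by (force simp: chart_ran_def c_def f_def)
    have s: "s = cross (E k) (f k) / L"
      using idx_less[OF k] h_idx[OF k] by (simp add: s_def u_def coords_def f_def L_def)
    have "(cross (E k) (f k))\<^sup>2 + (inner (E k) (f k))\<^sup>2 = L * L"
      using cross_inner_identity[of "E k" "f k"] inner_E[OF k'] ff[OF k'] by (simp add: L_def)
    then have sc: "s\<^sup>2 + c\<^sup>2 = 1"
      using L by (simp add: s c_def power_divide add_divide_distrib[symmetric] power2_eq_square)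
    then have "s\<^sup>2 < 1" using cpos by (smt (verit) zero_less_power)
    moreover have "sqrt (1 - s\<^sup>2) = c"
      using sc cpos by (intro real_sqrt_unique) auto
    then have "L *\<^sub>R free_edge u k = L *\<^sub>R f k"
      using plane_decomp[of "E k" "f k"] inner_E[OF k'] L
      by (simp add: free_edge_def s_def[symmetric] s c_def scaleR_add_right L_def[symmetric] inner_commute)
    then have "free_edge u k = f k" using L by simp
    ultimately show ?thesis by (simp add: s_def)
  qed
  have "W u = - (f 1 + (\<Sum>k\<in>F. f k))"
    using free moduli_edges(1)[OF M] by (simp add: W_def f_def)
  also have "\<dots> = f a + f b"
    unfolding neg_eq_iff_add_eq_0 using moduli_edges(2)[OF M] by (simp only: f_def[abs_def] add.assoc)
  finally have W: "W u = f a + f b" .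
  define w where "w = inner (W u) (W u)"
  define q where "q = w + (l a)\<^sup>2 - (l b)\<^sup>2"
  \<comment> \<open>Twice the area of the triangle spanned by the two links, hence half the root of
    the discriminant.\<close>
  define x where "x = cross (W u) (f a)"
  have x: "x > 0"
  proof -
    have "cross (f a) (f b) < 0"
      using X by (simp add: chart_ran_def f_def)
    then show ?thesis
      using cross_swap[of "f b" "f a"] by (simp add: x_def W cross_linear cross_self)
  qed
  have q: "inner (W u) (f a) = q / 2"
    using ff[OF ab_in(1)] ff[OF ab_in(2)]
    by (simp add: q_def w_def W inner_add_left inner_add_right inner_commute[of "f b" "f a"])
  have "x\<^sup>2 + (q / 2)\<^sup>2 = w * (l a)\<^sup>2"
    using cross_inner_identity[of "W u" "f a"] ff[OF ab_in(1)] by (simp add: q x_def w_def)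
  then have D: "discr u = (2 * x)\<^sup>2"
    by (simp add: discr_def w_def[symmetric] q_def[symmetric] power_divide power_mult_distrib algebra_simps)
  show "coords X \<in> chart_dom"
    unfolding u_def[symmetric] chart_dom_def
  proof (intro CollectI conjI allI impI)
    show "u i = 0" if "i \<ge> n - 3" for i using that by (simp add: u_def coords_def)
    show "(u j)\<^sup>2 < 1" if "j < n - 3" for j
      using free[OF h_in[OF that]] idx_h[OF that] by simp
    show "0 < discr u" using D x by simp
  qed
  then have w: "w > 0" using W_pos by (simp add: w_def u_def)
  have "sqrt (discr u) = 2 * x"
    unfolding D real_sqrt_abs using x by simp
  then have "(2 * w) *\<^sub>R edge_a u = q *\<^sub>R W u + (2 * x) *\<^sub>R rot (W u)"
  proof -
    assume sq: "sqrt (discr u) = 2 * x"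
    have "2 * w * (q * inverse (2 * w)) = q" "2 * w * (2 * x * inverse (2 * w)) = 2 * x"
      using w by (simp_all add: field_simps)
    then show ?thesis
      by (simp only: edge_a_def w_def[symmetric] q_def[symmetric] sq scaleR_add_right scaleR_scaleR)
  qed
  also have "\<dots> = 2 *\<^sub>R (w *\<^sub>R f a)"
    unfolding w_def plane_decomp[of "W u" "f a"]
    by (simp add: scaleR_add_right inner_commute[of "f a" "W u"] q x_def)
  finally have "(2 * w) *\<^sub>R edge_a u = (2 * w) *\<^sub>R f a"
    by simp
  then have ea: "edge_a u = f a"
    using w by simp
  have edge: "edge u k = f k" if "k \<in> {1..n}" for k
  proof -
    have "k = 1 \<or> k = a \<or> k = b \<or> k \<in> F" using that by (auto simp: F_def)
    then show ?thesis
    proof (elim disjE)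
      assume "k = 1"
      then show ?thesis
        using moduli_edges(1)[OF M] by (simp only: edge_ab f_def)
    qed (simp_all add: edge_ab edge_free free ea W)
  qed
  show "chart (coords X) = X"
    unfolding u_def[symmetric]
  proof
    fix i show "chart u i = X i"
    proof (cases "i \<in> {1..n}")
      case True
      then have "chart u i = (\<Sum>k=1..<i. f k)"
        unfolding chart_def using edge by (auto intro!: sum.cong)
      also have "\<dots> = X i"
        unfolding f_def by (rule vertex_eq_sum_edges[of X, OF moduli_edges(3)[OF M] True])
      finally show ?thesis .
    next
      case False
      then have "X i = 0" using M by (auto simp: moduli_space_def)
      then show ?thesis using False unfolding chart_def by (simp only: if_False)
    qed
  qed
qed

lemma chart_image: "chart ` chart_dom = chart_ran"
proof (intro equalityI subsetI)
  fix X assume "X \<in> chart_ran"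
  then show "X \<in> chart ` chart_dom"
    using chart_coords[of X] by (intro image_eqI[of _ chart "coords X"]) simp_all
qed (use chart_in_ran in blast)

lemma P_in_ran: "P \<in> chart_ran"
proof -
  have "0 < inner (E (h j)) (P (nxt n (h j)) - P (h j))" if "j < n - 3" for j
  proof -
    have "h j \<in> {1..n}" using h_in[OF that] F_subset by blast
    then show ?thesis
      unfolding E_def[symmetric] using inner_E[of "h j"] l_pos[of "h j"] by simp
  qed
  then show ?thesis
    using P_in cross_ab by (simp add: chart_ran_def)
qed

lemma continuous_on_discr: "continuous_on UNIV discr"
proof -
  have c: "continuous_on UNIV (\<lambda>u :: nat \<Rightarrow> real. u i)" for i
    by simp
  have "continuous_on UNIV W"
    unfolding W_def free_edge_def
    by (intro continuous_intros c)
  then show ?thesis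
    unfolding discr_def by (intro continuous_intros) auto
qed

lemma open_dom: "openin (Euclidean_space (n - 3)) chart_dom"
proof -
  have "open {u :: nat \<Rightarrow> real. (u j)\<^sup>2 < 1}" for j
    by (intro open_Collect_less continuous_intros) simp
  then have "open (\<Inter>j\<in>{..<n - 3}. {u :: nat \<Rightarrow> real. (u j)\<^sup>2 < 1})"
    by (intro open_INT) auto
  moreover have "open {u. 0 < discr u}"
    using continuous_on_discr by (intro open_Collect_less continuous_intros)
  ultimately have "open ((\<Inter>j\<in>{..<n - 3}. {u :: nat \<Rightarrow> real. (u j)\<^sup>2 < 1}) \<inter> {u. 0 < discr u})"
    by (rule open_Int)
  moreover have "chart_dom = ((\<Inter>j\<in>{..<n - 3}. {u :: nat \<Rightarrow> real. (u j)\<^sup>2 < 1}) \<inter> {u. 0 < discr u})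
      \<inter> {x. \<forall>i\<ge>n - 3. x i = 0}"
    by (auto simp: chart_dom_def)
  ultimately show ?thesis
    unfolding Euclidean_space_def openin_subtopology euclidean_product_topology open_openin[symmetric]
    by blast
qed

lemma open_ran: "openin (top_of_set (moduli_space n l)) chart_ran"
proof -
  have c: "continuous_on UNIV (\<lambda>X :: nat \<Rightarrow> point. X i)" for i
    by simp
  note bl = bounded_bilinear.continuous_on[OF bounded_bilinear_cross]
  have "open {X :: nat \<Rightarrow> point. 0 < inner (E (h j)) (X (nxt n (h j)) - X (h j))}" for j
    by (intro open_Collect_less continuous_intros c)
  then have "open (\<Inter>j\<in>{..<n - 3}. {X :: nat \<Rightarrow> point. 0 < inner (E (h j)) (X (nxt n (h j)) - X (h j))})"
    by (intro open_INT) auto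
  moreover have "open {X :: nat \<Rightarrow> point. cross (X (nxt n a) - X a) (X (nxt n b) - X b) < 0}"
    by (intro open_Collect_less continuous_intros bl c)
  ultimately have "open ((\<Inter>j\<in>{..<n - 3}. {X :: nat \<Rightarrow> point. 0 < inner (E (h j)) (X (nxt n (h j)) - X (h j))})
      \<inter> {X :: nat \<Rightarrow> point. cross (X (nxt n a) - X a) (X (nxt n b) - X b) < 0})"
    by (rule open_Int)
  then have "openin (top_of_set (moduli_space n l)) (moduli_space n l \<inter>
      ((\<Inter>j\<in>{..<n - 3}. {X :: nat \<Rightarrow> point. 0 < inner (E (h j)) (X (nxt n (h j)) - X (h j))})
      \<inter> {X :: nat \<Rightarrow> point. cross (X (nxt n a) - X a) (X (nxt n b) - X b) < 0}))"
    by (rule openin_open_Int)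
  then show ?thesis
    by (rule back_subst[of "openin _"]) (auto simp: chart_ran_def)
qed

text \<open>On \<open>chart_dom\<close> the arguments of both square roots are positive and the
  denominator \<open>2 * inner (W u) (W u)\<close> does not vanish.\<close>

lemma smooth_edge:
  assumes k: "k \<in> {1..n}"
  shows "smooth_on (n - 3) chart_dom (\<lambda>u. edge u k)"
proof -
  note intro = smooth_on_add[OF open_dom] smooth_on_diff[OF open_dom] smooth_on_minus[OF open_dom]
    smooth_on_scaleR[OF open_dom] smooth_on_mult[OF open_dom] smooth_on_power2[OF open_dom]
    smooth_on_const[OF open_dom] smooth_on_coord[OF open_dom] smooth_on_sum[OF open_dom]
    smooth_on_bilinear[OF open_dom bounded_bilinear_inner]
    smooth_on_linear[OF open_dom bounded_linear_rot]
  have free: "smooth_on (n - 3) chart_dom (\<lambda>u. free_edge u k)" if "k \<in> F" for k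
    unfolding free_edge_def using idx_less[OF that]
    by (intro intro smooth_on_sqrt[OF open_dom]) (auto simp: chart_dom_def)
  have W: "smooth_on (n - 3) chart_dom (\<lambda>u. W u)"
    unfolding W_def by (intro intro free)
  have D: "smooth_on (n - 3) chart_dom (\<lambda>u. sqrt (discr u))"
    by (rule smooth_on_sqrt[OF open_dom]) (simp add: chart_dom_def, unfold discr_def, intro intro W)
  have I: "smooth_on (n - 3) chart_dom (\<lambda>u. inverse (2 * inner (W u) (W u)))"
    by (rule smooth_on_inverse[OF open_dom]) (use W_pos in force, intro intro W)
  have A: "smooth_on (n - 3) chart_dom (\<lambda>u. edge_a u)"
    unfolding edge_a_def by (intro intro W D I)
  have "k = 1 \<or> k = a \<or> k = b \<or> k \<in> F"
    using k by (auto simp: F_def)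
  then show ?thesis
  proof (elim disjE)
    assume "k = 1"
    then show ?thesis
      by (simp only: edge_ab smooth_on_const[OF open_dom])
  next
    assume "k = a"
    then show ?thesis
      by (simp only: edge_ab A)
  next
    assume "k = b"
    then show ?thesis
      by (simp only: edge_ab smooth_on_diff[OF open_dom W A])
  next
    assume "k \<in> F"
    then show ?thesis
      by (simp only: edge_free free)
  qed
qed

lemma smooth_chart:
  assumes "i \<in> {1..n}"
  shows "smooth_on (n - 3) chart_dom (\<lambda>u. chart u i)"
  unfolding chart_def using assms
  by (simp, intro smooth_on_sum[OF open_dom] smooth_edge) auto

lemma chart_homeomorphism: "homeomorphism chart_dom (chart ` chart_dom) chart coords"
proof
  have c: "continuous_on S (\<lambda>X :: nat \<Rightarrow> point. X i)" for S i
    by (rule continuous_on_subset[OF continuous_on_product_coordinates subset_UNIV])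
  show "continuous_on chart_dom chart"
  proof (rule continuous_on_coordinatewise_then_product)
    fix i show "continuous_on chart_dom (\<lambda>u. chart u i)"
    proof (cases "i \<in> {1..n}")
      case True
      then show ?thesis by (rule smooth_on_imp_continuous_on[OF smooth_chart])
    next
      case False
      then have "chart u i = 0" for u by (auto simp: chart_def)
      then show ?thesis by simp
    qed
  qed
  show "continuous_on (chart ` chart_dom) coords"
  proof (rule continuous_on_coordinatewise_then_product)
    fix j
    note bl = bounded_bilinear.continuous_on[OF bounded_bilinear_cross]
    show "continuous_on (chart ` chart_dom) (\<lambda>X. coords X j)"
    proof (cases "j < n - 3")
      case True
      then have "l (h j) \<noteq> 0"
        using l_pos[of "h j"] h_in[OF True] F_subset by force
      then show ?thesis
        unfolding coords_def using True by (simp, intro continuous_intros bl c) auto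
    qed (simp add: coords_def)
  qed
  show "coords ` chart ` chart_dom \<subseteq> chart_dom"
    using coords_chart by auto
qed (use coords_chart in auto)

text \<open>The cross product of \<open>E (h k)\<close> with edge \<open>h k\<close> of the chart is
  a nonzero multiple of coordinate \<open>k\<close> alone; this functional extracts
  \<open>c k\<close> from a vanishing combination.\<close>

lemma chart_immersion:
  assumes u: "u \<in> chart_dom"
    and zero: "\<And>i. i \<in> {1..n} \<Longrightarrow> (\<Sum>j<n - 3. c j *\<^sub>R partial_deriv j (\<lambda>v. chart v i) u) = 0"
    and k: "k < n - 3"
  shows "c k = 0"
proof -
  define L where "L x = cross (E (h k)) x" for x
  have L: "bounded_linear L"
    unfolding L_def by (rule bounded_bilinear.bounded_linear_right[OF bounded_bilinear_cross])
  interpret L: bounded_linear L by fact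
  define d where "d j i = partial_deriv j (\<lambda>v. chart v i) u" for j i
  have hk: "h k \<in> {1..n}" using h_in[OF k] F_subset by blast
  have "L (d j (nxt n (h k))) - L (d j (h k)) = (if j = k then (l (h k))\<^sup>2 else 0)" if j: "j < n - 3" for j
  proof -
    have "((\<lambda>t. L (chart (u(j := t)) (nxt n (h k)) - chart (u(j := t)) (h k))) has_vector_derivative
        L (d j (nxt n (h k)) - d j (h k))) (at (u j))"
      unfolding d_def
      by (intro bounded_linear.has_vector_derivative[OF L] has_vector_derivative_diff
          smooth_on_partial[OF smooth_chart u j] hk nxt_mem)
    then have 1: "partial_deriv j (\<lambda>v. L (chart v (nxt n (h k)) - chart v (h k))) u
      = L (d j (nxt n (h k)) - d j (h k))"
      unfolding partial_deriv_def by (rule vector_derivative_at)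
    have 2: "L (chart v (nxt n (h k)) - chart v (h k)) = v k * (l (h k))\<^sup>2" if "v \<in> chart_dom" for v
      using free_edge_inner(3)[OF that h_in[OF k]]
      by (simp add: chart_edge[OF hk] edge_free h_in[OF k] idx_h[OF k] L_def)
    have "((\<lambda>t. (u(j := t)) k * (l (h k))\<^sup>2) has_vector_derivative (if j = k then (l (h k))\<^sup>2 else 0)) (at (u j))"
    proof (cases "j = k")
      case True
      have "((\<lambda>t. t * (l (h k))\<^sup>2) has_vector_derivative 1 * (l (h k))\<^sup>2) (at (u k))"
        by (intro has_vector_derivative_mult_left has_vector_derivative_id)
      then show ?thesis using True by simp
    qed simp
    then have "partial_deriv j (\<lambda>v. L (chart v (nxt n (h k)) - chart v (h k))) u
      = (if j = k then (l (h k))\<^sup>2 else 0)"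
      by (rule partial_deriv_eqI(2)[OF open_dom u j 2, rotated])
    then show ?thesis
      using 1 by (simp add: L.diff)
  qed
  then have "(\<Sum>j<n - 3. c j * (L (d j (nxt n (h k))) - L (d j (h k))))
      = (\<Sum>j<n - 3. if j = k then c j * (l (h k))\<^sup>2 else 0)"
    by (intro sum.cong) auto
  also have "\<dots> = c k * (l (h k))\<^sup>2"
    using k by simp
  finally have "c k * (l (h k))\<^sup>2
      = L (\<Sum>j<n - 3. c j *\<^sub>R d j (nxt n (h k))) - L (\<Sum>j<n - 3. c j *\<^sub>R d j (h k))"
    by (simp add: L.sum L.scaleR sum_subtractf right_diff_distrib)
  also have "\<dots> = 0"
    using zero[OF nxt_mem] zero[OF hk] by (simp add: d_def)
  finally show ?thesis
    using l_pos[OF hk] by simp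
qed

lemma local_param_chart: "local_param n l chart_dom chart"
  unfolding local_param_def
proof (intro conjI ballI allI impI)
  show "openin (Euclidean_space (n - 3)) chart_dom"
    by (rule open_dom)
  show "openin (top_of_set (moduli_space n l)) (chart ` chart_dom)"
    unfolding chart_image by (rule open_ran)
  show "\<exists>\<psi>. homeomorphism chart_dom (chart ` chart_dom) chart \<psi>"
    using chart_homeomorphism by blast
qed (use smooth_chart chart_immersion in auto)

lemma coords_P: "coords P \<in> chart_dom" "chart (coords P) = P"
  using chart_coords[OF P_in_ran] .

end

text \<open>Edge 1 is pinned, so \<open>two_link_chart\<close> takes two non-parallel edges among 2
  to \<open>n\<close>. If these were all parallel, edge 1 as minus their sum would be parallel to
  them too, and the vertices would be collinear.\<close>

lemma local_param_exists:
  assumes n: "n \<ge> 3" and l: "\<And>i. i \<in> {1..n} \<Longrightarrow> l i > 0"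
    and P: "P \<in> moduli_space n l" and noncoll: "\<not> collinear (P ` {1..n})"
  shows "\<exists>U \<phi> u. local_param n l U \<phi> \<and> u \<in> U \<and> \<phi> u = P"
proof -
  define e where "e k = P (nxt n k) - P k" for k
  have P1: "P 1 = 0"
    using P by (simp add: moduli_space_def zero_prod_def)
  have "\<exists>k\<in>{2..n}. cross (e 2) (e k) \<noteq> 0"
  proof (rule ccontr)
    assume "\<not> ?thesis"
    then have par: "cross (e 2) (e k) = 0" if "k \<in> {2..n}" for k using that by blast
    have "(\<Sum>k=1..n. e k) = 0"
      using sum_nxt[of n P] n by (simp add: e_def sum_subtractf)
    then have "e 1 + (\<Sum>k=2..n. e k) = 0"
      using n by (simp add: sum.atLeast_Suc_atMost numeral_2_eq_2)
    then have "e 1 = - (\<Sum>k=2..n. e k)"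
      by (simp add: add_eq_0_iff)
    moreover have sum_cross: "cross (e 2) (\<Sum>k\<in>K. e k) = (\<Sum>k\<in>K. cross (e 2) (e k))" for K
      by (rule linear_sum[OF bounded_linear.linear[OF
            bounded_bilinear.bounded_linear_right[OF bounded_bilinear_cross]]])
    ultimately have "cross (e 2) (e 1) = 0"
      using par by (simp add: cross_minus_right)
    then have par': "cross (e 2) (e k) = 0" if "k \<in> {1..n}" for k
      using par[of k] that by (cases "k = 1") auto
    have "inner (rot (e 2)) x = 0" if x: "x \<in> P ` {1..n}" for x
    proof -
      obtain i where i: "i \<in> {1..n}" "x = P i" using x by blast
      have "x = (\<Sum>k=1..<i. e k)"
        using vertex_eq_sum_edges[of P, OF P1 i(1)] i(2) by (simp add: e_def)
      then show ?thesis
        using par' i(1) by (simp add: inner_rot_left sum_cross)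
    qed
    moreover have "rot (e 2) \<noteq> 0"
    proof -
      have "inner (rot (e 2)) (rot (e 2)) = (l 2)\<^sup>2"
        using moduli_space_edge_sq[OF P, of 2] n by (simp add: inner_rot_rot e_def)
      then show ?thesis using l[of 2] n by auto
    qed
    ultimately show False
      using noncoll collinear_if_on_line by blast
  qed
  then obtain k where k: "k \<in> {2..n}" "cross (e 2) (e k) \<noteq> 0" by blast
  \<comment> \<open>The order of the pair is chosen so that the cross product is negative.\<close>
  obtain a b where ab: "a \<in> {2..n}" "b \<in> {2..n}" "cross (e a) (e b) < 0"
  proof (cases "cross (e 2) (e k) < 0")
    case True
    then show ?thesis using that[of 2 k] k n by simp
  next
    case False
    then show ?thesis using that[of k 2] k n cross_swap[of "e k" "e 2"] by simp
  qed
  then have "a \<noteq> b" by (auto simp: cross_self)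
  then have "card ({2..n} - {a, b}) = n - 3"
    using ab by (subst card_Diff_subset) auto
  then obtain h where "bij_betw h {..<n - 3} ({2..n} - {a, b})"
    using ex_bij_betw_nat_finite[of "{2..n} - {a, b}"] by (auto simp: atLeast0LessThan)
  then interpret two_link_chart n l P a b h
    using n l P ab \<open>a \<noteq> b\<close> by unfold_locales (auto simp: e_def)
  show ?thesis
    using local_param_chart coords_P by blast
qed

subsection \<open>The sign of the Hessian\<close>

text \<open>The equations of two circles with different centres differ by that of a line, the
  radical axis, which would contain all vertices.\<close>

lemma circumcenter_eq:
  assumes "\<not> collinear (P ` {1..n})" "P ` {1..n} \<subseteq> sphere c r" "r > 0"
  shows "circumcenter n P = c"
  unfolding circumcenter_def
proof (rule the_equality)
  show "\<exists>r>0. P ` {1..n} \<subseteq> sphere c r" using assms by blast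
  fix c' assume "\<exists>r>0. P ` {1..n} \<subseteq> sphere c' r"
  then obtain r' where r': "P ` {1..n} \<subseteq> sphere c' r'" by blast
  show "c' = c"
  proof (rule ccontr)
    assume "c' \<noteq> c"
    then have "c' - c \<noteq> 0" by simp
    moreover have "inner (c' - c) x = (r\<^sup>2 - r'\<^sup>2 + inner c' c' - inner c c) / 2"
      if "x \<in> P ` {1..n}" for x
    proof -
      have "inner (x - c) (x - c) = r\<^sup>2" "inner (x - c') (x - c') = r'\<^sup>2"
        using assms(2) r' that
        by (auto simp: dist_norm norm_minus_commute simp flip: power2_norm_eq_inner)
      then show ?thesis
        by (simp add: inner_diff_left inner_diff_right inner_commute)
    qed
    ultimately have "collinear (P ` {1..n})"
      by (rule collinear_if_on_line)
    then show False
      using assms(1) by contradiction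
  qed
qed

theorem theorem3p4:
  fixes n :: nat and l :: "nat \<Rightarrow> real" and P :: "nat \<Rightarrow> real \<times> real"
  assumes "linkage n l"
    and "generic_cyclic_conf n l P"
  shows "hessian_sign n l P = - sgn (delta n P) * (-1) ^ num_positive n P"
proof -
  have n: "n \<ge> 3" and l: "\<And>i. i \<in> {1..n} \<Longrightarrow> l i > 0"
    using assms(1) by (auto simp: linkage_def)
  have PM: "P \<in> moduli_space n l" and noncoll: "\<not> collinear (P ` {1..n})"
    and noncentral: "\<not> central_conf n P" and "cyclic_conf n P"
    using assms(2) by (auto simp: generic_cyclic_conf_def generic_linkage_def)
  then obtain c R where R: "R > 0" and cR: "P ` {1..n} \<subseteq> sphere c R"
    by (auto simp: cyclic_conf_def)
  have center: "circumcenter n P = c"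
    by (rule circumcenter_eq[OF noncoll cR R])
  define p where "p i = P i - c" for i
  have nxt: "nxt n i \<in> {1..n}" for i using n by (intro nxt_in) simp
  have norm_p: "norm (p i) = R" if "i \<in> {1..n}" for i
  proof -
    have "P i \<in> sphere c R" using cR that by blast
    then show ?thesis by (simp add: p_def dist_norm norm_minus_commute)
  qed
  have inner_p: "inner (p i) (p i) = R\<^sup>2" if "i \<in> {1..n}" for i
    using norm_p[OF that] by (simp flip: power2_norm_eq_inner)
  \<comment> \<open>Parallel vectors of equal length are equal or opposite: the edge would have
    length zero, or its midpoint would be the centre.\<close>
  have cross_p: "cross (p i) (p (nxt n i)) \<noteq> 0" if i: "i \<in> {1..n}" for i
  proof
    assume 0: "cross (p i) (p (nxt n i)) = 0"
    define t where "t = inner (p (nxt n i)) (p i) / R\<^sup>2"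
    have "R\<^sup>2 *\<^sub>R p (nxt n i) = inner (p (nxt n i)) (p i) *\<^sub>R p i"
      using plane_decomp[of "p i" "p (nxt n i)"] 0 inner_p[OF i] by simp
    then have t: "p (nxt n i) = t *\<^sub>R p i"
      using R by (simp add: t_def eq_vector_fraction_iff)
    have "norm (p (nxt n i)) = \<bar>t\<bar> * norm (p i)"
      unfolding t by simp
    then have "\<bar>t\<bar> = 1"
      using R norm_p[OF i] norm_p[OF nxt] by simp
    then consider "p (nxt n i) = p i" | "p (nxt n i) = - p i"
      using t by (auto simp: abs_if split: if_splits)
    then show False
    proof cases
      case 1
      then have "dist (P i) (P (nxt n i)) = 0" by (simp add: p_def)
      moreover have "dist (P i) (P (nxt n i)) = l i"
        using PM i by (simp add: moduli_space_def)
      ultimately show False using l[OF i] by simp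
    next
      case 2
      then have "c = (1 / 2) *\<^sub>R P i + (1 / 2) *\<^sub>R P (nxt n i)"
        by (simp add: p_def prod_eq_iff field_simps)
      then have "c \<in> closed_segment (P i) (P (nxt n i))"
        unfolding closed_segment_def by (auto intro!: exI[of _ "1 / 2"])
      then show False
        using noncentral center i by (auto simp: central_conf_def)
    qed
  qed
  interpret inscribed_polygon n p R
    using n R inner_p cross_p by unfold_locales auto
  \<comment> \<open>Both sides measure the triangle formed by an edge and the centre; on the right
    the centre has been moved to the origin.\<close>
  have orient: "edge_orientation n P i = sgn (cross (p i) (p (nxt n i)))" for i
    by (simp add: edge_orientation_def center side_def cross_def p_def algebra_simps)
  have "edge_orientation n P i * tan (half_angle n P i) = tau i" if i: "i \<in> {1..n}" for i
  proof -
    define S C where "S = cross (p i) (p (nxt n i))" and "C = inner (p i) (p (nxt n i))"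
    define x where "x = C / R\<^sup>2"
    have SC: "S\<^sup>2 + C\<^sup>2 = R\<^sup>2 * R\<^sup>2" and C: "\<bar>C\<bar> < R\<^sup>2" and S: "S \<noteq> 0"
      using cross_inner_p[OF i] abs_inner_p_less[OF i] cross_p[OF i] by (simp_all add: S_def C_def)
    have x: "-1 < x" "x < 1"
      using C R by (simp_all add: x_def field_simps)
    have ang: "half_angle n P i = arccos x / 2"
      using norm_p[OF i] norm_p[OF nxt]
      by (simp add: half_angle_def unoriented_angle_def center p_def[symmetric] x_def C_def power2_eq_square)
    \<comment> \<open>The half-angle formula for the unoriented angle; multiplication by the
      orientation then replaces \<open>\<bar>S\<bar>\<close> by \<open>S\<close>.\<close>
    have "tan (arccos x / 2) = sin (arccos x) / (cos (arccos x) + 1)"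
      by (subst tan_half) simp
    also have "\<dots> = sqrt (1 - x\<^sup>2) / (x + 1)"
      using x by (simp add: sin_arccos)
    also have "1 - x\<^sup>2 = (S / R\<^sup>2)\<^sup>2"
      using SC R by (simp add: x_def field_simps power2_eq_square)
    also have "sqrt ((S / R\<^sup>2)\<^sup>2) = \<bar>S\<bar> / R\<^sup>2"
      by simp
    also have "\<bar>S\<bar> / R\<^sup>2 / (x + 1) = \<bar>S\<bar> / (R\<^sup>2 + C)"
      using R by (simp add: x_def field_simps)
    finally have "tan (half_angle n P i) = \<bar>S\<bar> / (R\<^sup>2 + C)"
      by (simp add: ang)
    then have "edge_orientation n P i * tan (half_angle n P i) = S / (R\<^sup>2 + C)"
      by (simp add: orient S_def sgn_mult_abs)
    also have "\<dots> = (R\<^sup>2 - C) / S"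
    proof -
      have "S * S = (R\<^sup>2 - C) * (R\<^sup>2 + C)"
        using SC by (simp add: algebra_simps power2_eq_square)
      moreover have "R\<^sup>2 + C \<noteq> 0" using C by auto
      ultimately show ?thesis using S by (simp add: frac_eq_eq)
    qed
    finally show ?thesis
      by (simp add: tau_def S_def C_def)
  qed
  then have delta: "delta n P = (\<Sum>i=1..n. tau i)"
    by (simp add: delta_def)
  have "(\<Prod>i=1..n. - sgn (cross (p i) (p (nxt n i)))) = (-1) ^ num_positive n P"
  proof -
    \<comment> \<open>A positively oriented edge contributes -1, a negatively oriented one
      1.\<close>
    have "(\<Prod>i=1..n. - sgn (cross (p i) (p (nxt n i))))
      = (\<Prod>i\<in>{1..n}. if edge_orientation n P i > 0 then -1 else 1)"
      using cross_p by (intro prod.cong refl) (auto simp: orient sgn_if)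
    also have "\<dots> = (\<Prod>i\<in>{i\<in>{1..n}. edge_orientation n P i > 0}. -1)"
      by (subst prod.inter_filter) auto
    finally show ?thesis
      by (simp add: num_positive_def)
  qed
  then have sign: "sgn (Determinant.det (hessian (n - 3) (\<lambda>v. signed_area n (\<phi> v)) u))
      = - sgn (delta n P) * (-1) ^ num_positive n P"
    if "local_param n l U \<phi>" "u \<in> U" "\<phi> u = P" for U \<phi> u
    using chart_hessian_sign[OF _ noncoll that, of c] by (simp add: p_def delta)
  obtain U \<phi> u where "local_param n l U \<phi>" "u \<in> U" "\<phi> u = P"
    using local_param_exists[OF n l PM noncoll] by blast
  \<comment> \<open>A chart exists, and by \<open>sign\<close> its choice does not matter, so the
    description operator is well defined.\<close>
  then show ?thesis
    unfolding hessian_sign_def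
    by (intro the_equality) (auto simp: sign intro!: exI[of _ U] exI[of _ \<phi>] exI[of _ u])
qed

end
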